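(* The principal eigenvalue of the operator $$\mathcal L(v)=-\frac12\psi v_\psi-\sqrt{\bar\omega}\,v_{\psi\psi}-\frac{\bar\omega_{\psi\psi}}{2\sqrt{\bar\omega}}\,v$$ on $(0,\infty)$ is $1$, with associated eigenfunction $\psi\bar\omega_\psi$. That is, $$\inf_{\substack{v\in C_c^\infty[0,\infty),\ v\not\equiv0\\ v(0)=0}}\ \frac{\int_0^\infty\left(\rho v_\psi^2-\frac{\bar\omega_{\psi\psi}}{2\sqrt{\bar\omega}}A v^2\right)d\psi}{\int_0^\infty A v^2\,d\psi}=1 \qquad\text{and}\qquad \mathcal L(\psi\bar\omega_\psi)=\psi\bar\omega_\psi .$$
   Context: The Blasius function $f$ solves $f'''+ff''=0$ on $[0,\infty)$, $f(0)=f'(0)=0$, $f'(\infty)=1$. The function $\bar\omega$ on $[0,\infty)$ is defined by $\bar\omega(\psi)=(f'(z))^2$ with $\psi=\sqrt2 f(z)$; it satisfies $\sqrt{\bar\omega}\,\bar\omega_{\psi\psi}+\frac12\psi\bar\omega_\psi=0$, $\bar\omega(0)=0$, $\bar\omega(\infty)=1$. Weights: $\rho(\psi)=\exp\left(\int_0^\psi\frac{s}{2\sqrt{\bar\omega(s)}}ds\right)$, $A=\frac{\rho}{\sqrt{\bar\omega}}$, so that $A\mathcal L(v)=-(\rho v_\psi)_\psi-\frac{\bar\omega_{\psi\psi}}{2\sqrt{\bar\omega}}Av$. The principal eigenvalue of $\mathcal L$ is, by definition, the infimum of the Rayleigh quotient displayed in the claim. *)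

theory Defs
  imports "HOL-Analysis.Analysis"
begin

(* All functions live on the closed half-line {0..}: values at negative arguments are never used.
   Derivatives are therefore taken within {0..}: one-sided at 0 and the usual ones on {0<..}. *)
definition hderiv :: "(real \<Rightarrow> real) \<Rightarrow> real \<Rightarrow> real" where
  "hderiv g x = vector_derivative g (at x within {0..})"

lemma hderiv_eq_deriv:
  assumes "x > 0"
  shows "hderiv g x = deriv g x"
proof -
  have "at x within {0..} = at x"
    using assms by (intro at_within_interior) (simp add: interior_real_atLeast)
  then show ?thesis
    by (simp add: hderiv_def vector_derivative_def deriv_def
        has_real_derivative_iff_has_vector_derivative)
qed

definition blasius :: "(real \<Rightarrow> real) \<Rightarrow> bool" where
  "blasius f \<longleftrightarrow>
     (\<forall>k<3. \<forall>z\<ge>0. (hderiv ^^ k) f differentiable (at z within {0..})) \<and>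
     (\<forall>z\<ge>0. hderiv (hderiv (hderiv f)) z + f z * hderiv (hderiv f) z = 0) \<and>
     f 0 = 0 \<and> hderiv f 0 = 0 \<and> (hderiv f \<longlongrightarrow> 1) at_top"

(* For a Blasius function f, the map z \<mapsto> sqrt 2 * f z is a bijection of {0..} onto itself,
   so inv_into yields the unique z \<ge> 0 with \<psi> = sqrt 2 * f z. *)
definition omega :: "(real \<Rightarrow> real) \<Rightarrow> real \<Rightarrow> real" where
  "omega f \<psi> = (hderiv f (inv_into {0..} (\<lambda>z. sqrt 2 * f z) \<psi>))\<^sup>2"

definition rho :: "(real \<Rightarrow> real) \<Rightarrow> real \<Rightarrow> real" where
  "rho f \<psi> = exp (LBINT s:{0..\<psi>}. s / (2 * sqrt (omega f s)))"

definition weight_A :: "(real \<Rightarrow> real) \<Rightarrow> real \<Rightarrow> real" where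
  "weight_A f \<psi> = rho f \<psi> / sqrt (omega f \<psi>)"

definition op_L :: "(real \<Rightarrow> real) \<Rightarrow> (real \<Rightarrow> real) \<Rightarrow> real \<Rightarrow> real" where
  "op_L f v \<psi> =
     - (1/2) * \<psi> * hderiv v \<psi>
     - sqrt (omega f \<psi>) * hderiv (hderiv v) \<psi>
     - hderiv (hderiv (omega f)) \<psi> / (2 * sqrt (omega f \<psi>)) * v \<psi>"

(* C_c^\<infinity>[0,\<infinity>): smooth up to and including 0, where the support may reach 0. *)
definition Cc_infinity :: "(real \<Rightarrow> real) set" where
  "Cc_infinity = {v.
     (\<forall>k. \<forall>x\<ge>0. (hderiv ^^ k) v differentiable (at x within {0..})) \<and>
     compact (closure {x. x \<ge> 0 \<and> v x \<noteq> 0})}"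

definition rayleigh :: "(real \<Rightarrow> real) \<Rightarrow> (real \<Rightarrow> real) \<Rightarrow> real" where
  "rayleigh f v =
     (LBINT \<psi>:{0<..}. rho f \<psi> * (hderiv v \<psi>)\<^sup>2
        - hderiv (hderiv (omega f)) \<psi> / (2 * sqrt (omega f \<psi>)) * weight_A f \<psi> * (v \<psi>)\<^sup>2)
     / (LBINT \<psi>:{0<..}. weight_A f \<psi> * (v \<psi>)\<^sup>2)"

(* The infimum is taken in the extended reals, so that a finite value entails that the
   quotient is bounded below. *)
definition principal_eigenvalue :: "(real \<Rightarrow> real) \<Rightarrow> ereal" where
  "principal_eigenvalue f =
     (INF v \<in> {v \<in> Cc_infinity. v 0 = 0 \<and> (\<exists>\<psi>\<ge>0. v \<psi> \<noteq> 0)}. ereal (rayleigh f v))"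

(* Classical eigenfunction for the Dirichlet problem on {0<..}, matching the condition v 0 = 0
   on the test functions; the differentiability makes op_L f v meaningful. *)
definition is_eigenfunction :: "(real \<Rightarrow> real) \<Rightarrow> real \<Rightarrow> (real \<Rightarrow> real) \<Rightarrow> bool" where
  "is_eigenfunction f \<mu> v \<longleftrightarrow>
     continuous_on {0..} v \<and> v 0 = 0 \<and>
     (\<forall>\<psi>>0. v differentiable (at \<psi>) \<and> hderiv v differentiable (at \<psi>)) \<and>
     (\<exists>\<psi>>0. v \<psi> \<noteq> 0) \<and>
     (\<forall>\<psi>>0. op_L f v \<psi> = \<mu> * v \<psi>)"

end

theory Submission
  imports Defs
begin

text \<open>
  Write \<open>u\<close> for \<open>f'\<close> and \<open>\<tau>\<close> for \<open>f''\<close>, both regarded as functions of \<open>\<psi> = sqrt 2 * f z\<close>. The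
  Blasius equation turns into the system \<open>u' = \<tau> / (sqrt 2 * u)\<close> and \<open>\<tau>' = - \<psi> * \<tau> / (2 * u)\<close>
  with \<open>u > 0\<close> and \<open>\<tau> > 0\<close>, and everything in the claim becomes explicit: \<open>\<omega> = u\<^sup>2\<close>,
  \<open>\<omega>' = sqrt 2 * \<tau>\<close>, \<open>\<rho> = \<tau>(0) / \<tau>\<close> and \<open>A = \<rho> / u\<close>. That \<open>\<phi> = \<psi> * \<omega>'\<close> solves the eigenvalue
  equation with eigenvalue \<open>1\<close> is then a computation (\<open>eigenfunction\<close>), best organised through
  the Riccati equation of \<open>\<kappa> = \<phi>' / \<phi> = 1 / \<psi> - \<psi> / (2 * u)\<close> (\<open>kappa_riccati\<close>).

  Since \<open>\<phi>\<close> is positive, it is the ground state, and this can be seen without spectral theory: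
  completing the square with \<open>\<kappa>\<close> gives, for every admissible \<open>v\<close>,
  numerator minus denominator of the Rayleigh quotient \<open>= \<integral> \<rho> (v' - \<kappa> v)\<^sup>2\<close>
  (\<open>ground_state_identity\<close>). The right-hand side is nonnegative, hence the infimum is at least \<open>1\<close>
  (\<open>rayleigh_ge_1\<close>). The identity needs control of the singular coefficients at \<open>\<psi> = 0\<close>, where
  \<open>u\<close> vanishes; the linear bound \<open>velocity_ge\<close> together with \<open>v = O(\<psi>)\<close> suffices.

  The square vanishes only for multiples of \<open>\<phi>\<close>, which are not admissible: \<open>\<phi>\<close> has unbounded
  support and is not smooth at \<open>0\<close>. So the infimum is approached rather than attained. For
  \<open>v = \<phi> * \<chi>\<close> with a cut-off \<open>\<chi>\<close> compactly supported in the open half-line, the square above is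
  \<open>\<rho> \<phi>\<^sup>2 \<chi>'\<^sup>2 = 2 * \<tau>(0) * \<tau> * (\<psi> \<chi>')\<^sup>2\<close>. The factor \<open>\<psi> \<chi>'\<close> is invariant under dilations, so
  cut-offs at the scales \<open>1 / n\<close> and \<open>n\<close> keep it bounded and make it tend to \<open>0\<close> pointwise, and
  \<open>\<tau>\<close> is integrable; dominated convergence shows that the quotients of these trial functions tend
  to \<open>1\<close> (\<open>rayleigh_trial_tendsto\<close>).
\<close>

section \<open>Derivatives and smoothness on the closed half-line\<close>

lemma hderiv_eqI:
  assumes "x \<ge> 0" "(g has_real_derivative d) (at x within {0..})"
  shows "hderiv g x = d"
proof -
  have "x islimpt {0..x + 1}"
    using assms(1) by (intro connected_imp_perfect) auto
  then have "at x within {0..} \<noteq> bot"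
    by (auto simp: trivial_limit_within intro: islimpt_subset)
  then show ?thesis
    unfolding hderiv_def using assms(2)
    by (intro vector_derivative_within) (simp_all add: has_real_derivative_iff_has_vector_derivative)
qed

lemma hderivI:
  assumes "g differentiable (at x within {0..})"
  shows "(g has_real_derivative hderiv g x) (at x within {0..})"
  using assms unfolding hderiv_def
  by (simp add: has_real_derivative_iff_has_vector_derivative vector_derivative_works)

lemma at_within_halfline: "x > 0 \<Longrightarrow> at x within {0..} = at (x::real)"
  by (intro at_within_interior) (simp add: interior_real_atLeast)

lemma hderiv_eqI_pos:
  assumes "x > 0" "(g has_real_derivative d) (at x)"
  shows "hderiv g x = d"
  using assms hderiv_eqI[of x g d] by (simp add: at_within_halfline)

lemma hderiv_transform:
  assumes S: "openin (top_of_set {0..}) S" "x \<in> S" and eq: "\<And>y. y \<in> S \<Longrightarrow> g y = h y"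
    and g: "(g has_real_derivative d) (at x within {0..})"
  shows "(h has_real_derivative d) (at x within {0..})"
proof -
  obtain T where T: "open T" "S = {0..} \<inter> T"
    using S(1) by (auto simp: openin_open)
  have "eventually (\<lambda>y. y \<in> T \<and> y \<in> {0..}) (at x within {0..})"
    using T S(2) by (auto simp: eventually_at_topological)
  then have "eventually (\<lambda>y. g y = h y) (at x within {0..})"
    by eventually_elim (use T eq in auto)
  then show ?thesis
    using has_field_derivative_cong_eventually[of g h x "{0..}" d] eq S(2) g by simp
qed

text \<open>Recursion on the order lets closure under products and reciprocals be proved by induction
  without a Leibniz or Faa di Bruno formula. The closure lemmas ask only that \<open>S\<close> be open
  relative to the half-line, so that a neighbourhood \<open>{0..<d}\<close> of the endpoint is admissible and
  can be united with \<open>{0<..}\<close>.\<close>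

primrec diff_order :: "nat \<Rightarrow> real set \<Rightarrow> (real \<Rightarrow> real) \<Rightarrow> bool" where
  "diff_order 0 S h \<longleftrightarrow> True"
| "diff_order (Suc n) S h \<longleftrightarrow>
     (\<forall>x\<in>S. (h has_real_derivative hderiv h x) (at x within {0..})) \<and> diff_order n S (hderiv h)"

lemma diff_order_cong:
  assumes "openin (top_of_set {0..}) S" "\<And>x. x \<in> S \<Longrightarrow> g x = h x" "diff_order n S g"
  shows "diff_order n S h"
  using assms(2,3)
proof (induction n arbitrary: g h)
  case (Suc n)
  have S: "x \<ge> 0" if "x \<in> S" for x
    using assms(1) that by (auto simp: openin_open)
  have d: "(h has_real_derivative hderiv g x) (at x within {0..})" if "x \<in> S" for x
    using hderiv_transform[OF assms(1) that Suc.prems(1)] Suc.prems(2) that by auto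
  then have "hderiv h x = hderiv g x" if "x \<in> S" for x
    using that S by (intro hderiv_eqI) auto
  then show ?case
    using d Suc.IH[of "hderiv g" "hderiv h"] Suc.prems(2) by auto
qed simp

lemma diff_order_SucI:
  assumes S: "openin (top_of_set {0..}) S"
    and d: "\<And>x. x \<in> S \<Longrightarrow> (h has_real_derivative h' x) (at x within {0..})"
    and h': "diff_order n S h'"
  shows "diff_order (Suc n) S h"
proof -
  have "x \<ge> 0" if "x \<in> S" for x
    using S that by (auto simp: openin_open)
  then have "hderiv h x = h' x" if "x \<in> S" for x
    using that d by (intro hderiv_eqI) auto
  then show ?thesis
    using d diff_order_cong[OF S _ h', of "hderiv h"] by auto
qed

lemma diff_order_Suc_D: "diff_order (Suc n) S h \<Longrightarrow> diff_order n S h"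
  by (induction n arbitrary: h) auto

lemma diff_order_Un: "diff_order n S h \<Longrightarrow> diff_order n T h \<Longrightarrow> diff_order n (S \<union> T) h"
  by (induction n arbitrary: h) auto

lemma diff_order_const:
  assumes "openin (top_of_set {0..}) S"
  shows "diff_order n S (\<lambda>x. c)"
proof (induction n arbitrary: c)
  case (Suc n)
  show ?case by (rule diff_order_SucI[OF assms _ Suc[of 0]]) auto
qed simp

lemma diff_order_id:
  assumes "openin (top_of_set {0..}) S"
  shows "diff_order n S (\<lambda>x. x)"
proof (cases n)
  case (Suc m)
  show ?thesis unfolding Suc by (rule diff_order_SucI[OF assms _ diff_order_const[OF assms, of _ 1]]) auto
qed simp

lemma diff_order_add:
  assumes S: "openin (top_of_set {0..}) S"
  shows "diff_order n S g \<Longrightarrow> diff_order n S h \<Longrightarrow> diff_order n S (\<lambda>x. g x + h x)"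
proof (induction n arbitrary: g h)
  case (Suc n)
  show ?case
    by (rule diff_order_SucI[OF S, where h' = "\<lambda>x. hderiv g x + hderiv h x"])
       (use Suc in \<open>auto intro!: derivative_eq_intros\<close>)
qed simp

lemma diff_order_mult:
  assumes S: "openin (top_of_set {0..}) S"
  shows "diff_order n S g \<Longrightarrow> diff_order n S h \<Longrightarrow> diff_order n S (\<lambda>x. g x * h x)"
proof (induction n arbitrary: g h)
  case (Suc n)
  show ?case
  proof (rule diff_order_SucI[OF S, where h' = "\<lambda>x. hderiv g x * h x + hderiv h x * g x"])
    show "diff_order n S (\<lambda>x. hderiv g x * h x + hderiv h x * g x)"
      using Suc diff_order_Suc_D[OF Suc.prems(1)] diff_order_Suc_D[OF Suc.prems(2)]
      by (intro diff_order_add[OF S] Suc.IH) auto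
  qed (use Suc.prems in \<open>auto intro!: derivative_eq_intros\<close>)
qed simp

lemma diff_order_inverse:
  assumes S: "openin (top_of_set {0..}) S" and nz: "\<And>x. x \<in> S \<Longrightarrow> h x \<noteq> 0"
  shows "diff_order n S h \<Longrightarrow> diff_order n S (\<lambda>x. inverse (h x))"
proof (induction n)
  case (Suc n)
  have ih: "diff_order n S (\<lambda>x. inverse (h x))"
    using Suc diff_order_Suc_D by blast
  show ?case
  proof (rule diff_order_SucI[OF S,
        where h' = "\<lambda>x. (-1) * (inverse (h x) * hderiv h x * inverse (h x))"])
    show "diff_order n S (\<lambda>x. (-1) * (inverse (h x) * hderiv h x * inverse (h x)))"
      using Suc.prems by (intro diff_order_mult[OF S] diff_order_const[OF S] ih) auto
  qed (use Suc.prems nz in \<open>auto intro!: derivative_eq_intros\<close>)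
qed simp

lemma diff_order_iterate:
  "diff_order n {0..} h \<Longrightarrow> k < n \<Longrightarrow> x \<ge> 0 \<Longrightarrow> (hderiv ^^ k) h differentiable (at x within {0..})"
proof (induction k arbitrary: n h)
  case 0
  then show ?case
    by (cases n) (auto simp: differentiable_def has_field_derivative_def)
next
  case (Suc k)
  from \<open>Suc k < n\<close> obtain m where n: "n = Suc m" by (cases n) auto
  have "(hderiv ^^ k) (hderiv h) differentiable (at x within {0..})"
    using Suc.IH[of m "hderiv h"] Suc.prems n by auto
  then show ?case
    by (simp add: funpow_swap1)
qed

section \<open>Integrals over the open half-line\<close>

lemma set_integrable_halfline:
  fixes g :: "real \<Rightarrow> real"
  assumes cont: "continuous_on {0<..} g" and bnd: "bounded (g ` {0<..M})"
    and zero: "\<And>x. M < x \<Longrightarrow> 0 < x \<Longrightarrow> g x = 0"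
  shows "set_integrable lborel {0<..} g"
proof -
  obtain C where "\<forall>x\<in>{0<..M}. \<bar>g x\<bar> \<le> C"
    using bnd by (auto simp: bounded_iff)
  then have bnd: "\<bar>g x\<bar> \<le> C" if "0 < x" "x \<le> M" for x
    using that by auto
  show ?thesis
  proof (rule set_integrable_bound)
    have "set_integrable lborel {0..M} (\<lambda>x. C)"
      by (rule borel_integrable_atLeastAtMost') auto
    then show "set_integrable lborel {0<..} (\<lambda>x. indicator {0..M} x * C)"
      unfolding set_integrable_def
      by (rule Bochner_Integration.integrable_bound)
         (auto simp: indicator_def set_borel_measurable_def split: if_splits)
    show "set_borel_measurable lborel {0<..} g"
      unfolding set_borel_measurable_def
      using borel_measurable_continuous_on_indicator[OF _ cont] by simp
    show "AE x in lborel. x \<in> {0<..} \<longrightarrow> norm (g x) \<le> norm (indicator {0..M} x * C)"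
    proof (intro AE_I2 impI)
      fix x :: real assume "x \<in> {0<..}"
      then show "norm (g x) \<le> norm (indicator {0..M} x * C)"
        using bnd[of x] zero[of x] by (cases "x \<le> M") (auto simp: indicator_def)
    qed
  qed
qed

lemma set_integral_halfline_FTC:
  fixes F g :: "real \<Rightarrow> real"
  assumes F: "\<And>x. 0 < x \<Longrightarrow> (F has_real_derivative g x) (at x)"
    and cont: "continuous_on {0<..} g"
    and int: "set_integrable lborel {0<..} g"
    and A: "(F \<longlongrightarrow> A) (at_right 0)" and B: "(F \<longlongrightarrow> B) at_top"
  shows "(LBINT x:{0<..}. g x) = B - A"
proof -
  have "(LBINT x=ereal 0..\<infinity>. g x) = B - A"
  proof (rule interval_integral_FTC_integrable)
    show "isCont g x" if "ereal 0 < ereal x" for x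
      using cont that by (simp add: continuous_on_eq_continuous_at)
  qed (use F int A B in \<open>auto simp: ereal_tendsto_simps has_real_derivative_iff_has_vector_derivative
        \<close>)
  then show ?thesis
    by (simp add: interval_integral_to_infinity_eq)
qed

lemma set_integral_halfline_ge:
  fixes g :: "real \<Rightarrow> real"
  assumes int: "set_integrable lborel {0<..} g" and nn: "\<And>x. 0 < x \<Longrightarrow> 0 \<le> g x"
    and ab: "0 < a" "a \<le> b" and m: "\<And>x. a \<le> x \<Longrightarrow> x \<le> b \<Longrightarrow> m \<le> g x"
  shows "m * (b - a) \<le> (LBINT x:{0<..}. g x)"
proof -
  have "m * (b - a) = (LBINT x:{a..b}. m)"
    using ab by (simp add: set_lebesgue_integral_def)
  also have "\<dots> \<le> (LBINT x:{a..b}. g x)"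
    using ab m
    by (intro set_integral_mono set_integrable_subset[OF int] borel_integrable_atLeastAtMost') auto
  also have "\<dots> \<le> (LBINT x:{0<..}. g x)"
    unfolding set_lebesgue_integral_def
  proof (rule integral_mono)
    show "integrable lborel (\<lambda>x. indicator {a..b} x *\<^sub>R g x)"
      using ab set_integrable_subset[OF int, of "{a..b}"] unfolding set_integrable_def
      by (auto simp: subset_iff)
    show "integrable lborel (\<lambda>x. indicator {0<..} x *\<^sub>R g x)"
      using int unfolding set_integrable_def .
  qed (use ab nn in \<open>auto simp: indicator_def\<close>)
  finally show ?thesis .
qed

lemma set_integral_halfline_pos:
  fixes g :: "real \<Rightarrow> real"
  assumes int: "set_integrable lborel {0<..} g" and nn: "\<And>x. 0 < x \<Longrightarrow> 0 \<le> g x"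
    and cont: "continuous_on {0<..} g" and x0: "0 < x0" "0 < g x0"
  shows "0 < (LBINT x:{0<..}. g x)"
proof -
  have "isCont g x0"
    using cont x0 by (simp add: continuous_on_eq_continuous_at)
  then obtain d where d: "d > 0" "\<And>x. \<bar>x - x0\<bar> < d \<Longrightarrow> \<bar>g x - g x0\<bar> < g x0 / 2"
    using x0 unfolding continuous_at_eps_delta dist_real_def by (meson half_gt_zero)
  have "g x0 / 2 * (x0 + d / 2 - x0) \<le> (LBINT x:{0<..}. g x)"
  proof (rule set_integral_halfline_ge[OF int nn])
    fix x assume "x0 \<le> x" "x \<le> x0 + d / 2"
    then show "g x0 / 2 \<le> g x" using d(1) d(2)[of x] by linarith
  qed (use x0 d in auto)
  moreover have "0 < g x0 / 2 * (x0 + d / 2 - x0)" using x0 d by simp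
  ultimately show ?thesis by linarith
qed

section \<open>The flat cut-off\<close>

definition flat :: "real \<Rightarrow> real" where
  "flat x = (if x > 0 then exp (- 1 / x) else 0)"

definition flat' :: "real \<Rightarrow> real" where
  "flat' x = (if x > 0 then exp (- 1 / x) / x\<^sup>2 else 0)"

text \<open>The class of functions \<open>poly p (1 / x) * flat x\<close> is closed under differentiation, also at
  \<open>0\<close>, because \<open>exp (- t)\<close> beats every polynomial in \<open>t = 1 / x\<close>. Hence \<open>flat\<close> is smooth.\<close>

lemma flat_poly_derivative:
  "((\<lambda>x. poly p (1 / x) * flat x) has_real_derivative
     poly ([:0, 0, 1:] * (p - pderiv p)) (1 / x) * flat x) (at x)"
proof -
  consider "x > 0" | "x < 0" | "x = 0" by linarith
  then show ?thesis
  proof cases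
    case 1
    have "((\<lambda>x. poly p (1 / x) * exp (- 1 / x)) has_real_derivative
       poly ([:0, 0, 1:] * (p - pderiv p)) (1 / x) * flat x) (at x)"
      using 1 by (auto intro!: derivative_eq_intros simp: flat_def power2_eq_square field_simps)
    then show ?thesis
      by (rule has_field_derivative_transform_within_open[where S = "{0<..}"]) (use 1 in \<open>auto simp: flat_def\<close>)
  next
    case 2
    have "((\<lambda>x. 0) has_real_derivative poly ([:0, 0, 1:] * (p - pderiv p)) (1 / x) * flat x) (at x)"
      using 2 by (simp add: flat_def)
    then show ?thesis
      by (rule has_field_derivative_transform_within_open[where S = "{..<0}"]) (use 2 in \<open>auto simp: flat_def\<close>)
  next
    case 3
    have lim: "((\<lambda>t. poly q t * exp (- t)) \<longlongrightarrow> 0) at_top" for q :: "real poly"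
    proof -
      have "((\<lambda>t. \<Sum>i\<le>degree q. coeff q i * (t ^ i / exp t)) \<longlongrightarrow> 0) at_top"
        by (intro tendsto_null_sum tendsto_mult_right_zero tendsto_power_div_exp_0)
      then show ?thesis
        by (simp add: poly_altdef sum_distrib_right exp_minus divide_inverse mult.assoc)
    qed
    have "((\<lambda>h. poly (pCons 0 p) (inverse h) * exp (- inverse h)) \<longlongrightarrow> 0) (at_right 0)"
      by (rule filterlim_compose[OF lim filterlim_inverse_at_top_right])
    then have "((\<lambda>h. poly p (1 / h) * flat h / h) \<longlongrightarrow> 0) (at_right 0)"
      by (rule Lim_transform_eventually)
         (auto simp: eventually_at_right_less eventually_at_right_field flat_def field_simps intro!: exI[of _ 1])
    moreover have "((\<lambda>h. poly p (1 / h) * flat h / h) \<longlongrightarrow> 0) (at_left 0)"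
      by (rule Lim_transform_eventually[OF tendsto_const])
         (auto simp: eventually_at_left_field flat_def intro!: exI[of _ "-1"])
    ultimately have "((\<lambda>h. poly p (1 / h) * flat h / h) \<longlongrightarrow> 0) (at 0)"
      by (simp add: filterlim_split_at)
    then show ?thesis
      using 3 by (simp add: has_field_derivative_iff flat_def)
  qed
qed


lemma flat_derivative: "(flat has_real_derivative flat' x) (at x)"
proof -
  have "poly ([:0, 0, 1:] * (1 - pderiv 1)) (1 / x) * flat x = flat' x"
    by (simp add: flat_def flat'_def power2_eq_square)
  then show ?thesis
    using flat_poly_derivative[of 1 x] by simp
qed

lemma diff_order_flat_affine:
  assumes S: "openin (top_of_set {0..}) S"
  shows "diff_order n S (\<lambda>x. flat (c * x + d))"
proof -
  have "diff_order n S (\<lambda>x. poly p (1 / (c * x + d)) * flat (c * x + d))" for p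
  proof (induction n arbitrary: p)
    case (Suc n)
    show ?case
    proof (rule diff_order_SucI[OF S _
          Suc.IH[of "smult c ([:0, 0, 1:] * (p - pderiv p))"]])
      fix x
      have "((\<lambda>x. c * x + d) has_real_derivative c) (at x within {0..})"
        by (auto intro!: derivative_eq_intros)
      from DERIV_chain2[OF flat_poly_derivative[of p "c * x + d"] this]
      show "((\<lambda>x. poly p (1 / (c * x + d)) * flat (c * x + d)) has_real_derivative
          poly (smult c ([:0, 0, 1:] * (p - pderiv p))) (1 / (c * x + d)) * flat (c * x + d))
          (at x within {0..})"
        by (simp add: mult_ac)
    qed
  qed simp
  from this[of 1] show ?thesis by simp
qed

lemma flat_bounds: "0 \<le> flat x" "flat x \<le> 1"
  by (auto simp: flat_def)

lemma flat_ge: "1 \<le> x \<Longrightarrow> exp (- 1) \<le> flat x"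
  by (simp add: flat_def)

lemma flat'_nonneg: "0 \<le> flat' x"
  by (simp add: flat'_def)

text \<open>With \<open>t = 1 / x\<close> both expressions are polynomials in \<open>t\<close> of degree two, divided by
  \<open>exp t \<ge> 1 + t + t\<^sup>2 / 2\<close>. The second one is the dilation-invariant quantity of the transition
  near \<open>0\<close>.\<close>

lemma flat'_le: "flat' x \<le> 2" and flat'_weighted_le: "(x + 1) * flat' x \<le> 3"
proof -
  have "flat' x \<le> 2 \<and> (x + 1) * flat' x \<le> 3"
  proof (cases "x > 0")
    case True
    define t where "t = 1 / x"
    have t: "t > 0" "1 + t + t\<^sup>2 / 2 \<le> exp t"
      using True exp_lower_Taylor_quadratic[of t] by (auto simp: t_def)
    have eq: "flat' x = t\<^sup>2 / exp t" "(x + 1) * flat' x = (t + t\<^sup>2) / exp t"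
      using True by (auto simp: flat'_def t_def exp_minus power2_eq_square field_simps)
    have "t\<^sup>2 \<le> 2 * exp t" "t + t\<^sup>2 \<le> 3 * exp t"
      using t zero_le_power2[of t] by linarith+
    then show ?thesis
      unfolding eq(2) unfolding eq(1) by (simp add: pos_divide_le_eq)
  qed (simp add: flat'_def)
  then show "flat' x \<le> 2" "(x + 1) * flat' x \<le> 3" by auto
qed

text \<open>For \<open>n > 0\<close> it vanishes on \<open>{..1 / n}\<close> and on \<open>{2 * n..}\<close>. Both transitions are rescalings of fixed
  profiles, so \<open>x * cutoff' n x\<close>, being invariant under dilations, stays bounded uniformly in
  \<open>n\<close> and tends to \<open>0\<close> at every point. The cut-off itself tends to the constant
  \<open>exp (- 1 / 2)\<close>; since Rayleigh quotients are homogeneous it need not reach \<open>1\<close>.\<close>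

definition cutoff :: "nat \<Rightarrow> real \<Rightarrow> real" where
  "cutoff n x = flat (n * x - 1) * flat (2 - x / n)"

definition cutoff' :: "nat \<Rightarrow> real \<Rightarrow> real" where
  "cutoff' n x = n * flat' (n * x - 1) * flat (2 - x / n) - flat (n * x - 1) * flat' (2 - x / n) / n"

lemma cutoff_derivative:
  "(cutoff n has_real_derivative cutoff' n x) (at x)"
proof -
  have a: "((\<lambda>x. real n * x - 1) has_real_derivative n) (at x)"
    and b: "((\<lambda>x. 2 - x / real n) has_real_derivative (- 1 / n)) (at x)"
    by (cases "n = 0"; auto intro!: derivative_eq_intros)+
  show ?thesis
    unfolding cutoff_def[abs_def] cutoff'_def
    using DERIV_mult[OF DERIV_chain2[OF flat_derivative a] DERIV_chain2[OF flat_derivative b]]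
    by (simp add: mult_ac)
qed

lemma diff_order_cutoff:
  assumes "openin (top_of_set {0..}) S"
  shows "diff_order k S (cutoff n)"
  using diff_order_mult[OF assms diff_order_flat_affine[OF assms, of k n "- 1"]
      diff_order_flat_affine[OF assms, of k "- (1 / n)" 2]]
  by (simp add: cutoff_def[abs_def] field_simps)

lemma cutoff'_bounded:
  assumes "n > 0" "x > 0"
  shows "\<bar>x * cutoff' n x\<bar> \<le> n * x * flat' (n * x - 1) + x / n * flat' (2 - x / n)"
    "\<bar>x * cutoff' n x\<bar> \<le> 7"
proof -
  have le: "p * q \<le> p" if "0 \<le> p" "0 \<le> q" "q \<le> 1" for p q :: real
    using that mult_left_mono[of q 1 p] by simp
  have "n * x * flat' (n * x - 1) * flat (2 - x / n) \<le> n * x * flat' (n * x - 1)"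
    "x / n * flat' (2 - x / n) * flat (n * x - 1) \<le> x / n * flat' (2 - x / n)"
    using assms by (intro le; simp add: flat_bounds flat'_nonneg)+
  moreover have "0 \<le> n * x * flat' (n * x - 1) * flat (2 - x / n)"
    "0 \<le> x / n * flat' (2 - x / n) * flat (n * x - 1)"
    using assms by (simp_all add: flat_bounds flat'_nonneg)
  moreover have "x * cutoff' n x = n * x * flat' (n * x - 1) * flat (2 - x / n)
      - x / n * flat' (2 - x / n) * flat (n * x - 1)"
    by (simp add: cutoff'_def algebra_simps)
  ultimately show *: "\<bar>x * cutoff' n x\<bar> \<le> n * x * flat' (n * x - 1) + x / n * flat' (2 - x / n)"
    by linarith
  have "n * x * flat' (n * x - 1) \<le> 3"
    using flat'_weighted_le[of "n * x - 1"] by simp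
  moreover have "x / n * flat' (2 - x / n) \<le> 2 * 2"
  proof (cases "x / n \<le> 2")
    case True
    then show ?thesis
      using assms by (intro mult_mono flat'_le flat'_nonneg) auto
  qed (simp add: flat'_def)
  ultimately show "\<bar>x * cutoff' n x\<bar> \<le> 7"
    using * by linarith
qed

lemma cutoff'_tendsto_0:
  assumes "x > 0"
  shows "(\<lambda>n. x * cutoff' n x) \<longlonglongrightarrow> 0"
proof (rule Lim_null_comparison)
  have "\<forall>\<^sub>F n in sequentially. 2 / x \<le> real n \<and> 0 < n"
    using eventually_gt_at_top[of 0] filterlim_real_sequentially
    by (intro eventually_conj) (auto simp: filterlim_at_top)
  then show "\<forall>\<^sub>F n in sequentially. norm (x * cutoff' n x) \<le> (4 / x + 2 * x) * inverse (real n)"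
  proof eventually_elim
    case (elim n)
    define y where "y = n * x"
    have y: "y \<ge> 2" using elim assms by (simp add: y_def field_simps)
    have "y * flat' (y - 1) \<le> y * (1 / (y - 1)\<^sup>2)"
      using y by (intro mult_left_mono) (auto simp: flat'_def divide_right_mono)
    also have "\<dots> \<le> y * (1 / (y / 2)\<^sup>2)"
      using y by (intro mult_left_mono divide_left_mono power_mono) auto
    also have "\<dots> = 4 / x * inverse n"
      using elim assms by (simp add: y_def power2_eq_square field_simps)
    finally have "n * x * flat' (n * x - 1) \<le> 4 / x * inverse n" by (simp add: y_def)
    moreover have "x / n * flat' (2 - x / n) \<le> x / n * 2"
      using assms by (intro mult_left_mono flat'_le) auto
    moreover have "4 / x * inverse n + x / n * 2 = (4 / x + 2 * x) * inverse (real n)"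
      by (simp add: ring_distribs divide_inverse)
    ultimately show ?case
      using cutoff'_bounded(1)[of n x] elim assms by simp
  qed
  show "(\<lambda>n. (4 / x + 2 * x) * inverse (real n)) \<longlonglongrightarrow> 0"
    by (rule tendsto_mult_right_zero[OF lim_inverse_n])
qed

section \<open>The Blasius flow in von Mises variables\<close>

lemma halfline_mvt:
  fixes h h' :: "real \<Rightarrow> real"
  assumes ab: "0 \<le> a" "a < b" and cont: "continuous_on {0..} h"
    and d: "\<And>x. 0 < x \<Longrightarrow> (h has_real_derivative h' x) (at x)"
  obtains \<xi> where "a < \<xi>" "\<xi> < b" "h b - h a = h' \<xi> * (b - a)"
proof -
  have "continuous_on {a..b} h"
    by (rule continuous_on_subset[OF cont]) (use ab in auto)
  moreover have "(h has_derivative (*) (h' x)) (at x)" if "a < x" "x < b" for x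
    using d[of x] ab that by (simp add: has_field_derivative_def)
  ultimately show thesis
    using mvt[OF ab(2), of h "\<lambda>x. (*) (h' x)"] that by blast
qed

locale blasius_flow =
  fixes f :: "real \<Rightarrow> real"
  assumes blasius: "blasius f"
begin

abbreviation f1 :: "real \<Rightarrow> real" where "f1 \<equiv> hderiv f"
abbreviation f2 :: "real \<Rightarrow> real" where "f2 \<equiv> hderiv f1"

lemma has_derivs_within:
  assumes "z \<ge> 0"
  shows "(f has_real_derivative f1 z) (at z within {0..})"
    and "(f1 has_real_derivative f2 z) (at z within {0..})"
    and "(f2 has_real_derivative - f z * f2 z) (at z within {0..})"
proof -
  have "\<forall>k<3. (hderiv ^^ k) f differentiable (at z within {0..})"
    using blasius assms unfolding blasius_def by blast
  from this[rule_format, of 0] this[rule_format, of 1] this[rule_format, of 2]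
  have d: "f differentiable (at z within {0..})" "f1 differentiable (at z within {0..})"
    "f2 differentiable (at z within {0..})"
    by (simp_all add: numeral_2_eq_2)
  show "(f has_real_derivative f1 z) (at z within {0..})"
    "(f1 has_real_derivative f2 z) (at z within {0..})"
    using d by (auto intro: hderivI)
  have "hderiv f2 z + f z * f2 z = 0"
    using blasius assms unfolding blasius_def by blast
  then have "hderiv f2 z = - f z * f2 z" by linarith
  then show "(f2 has_real_derivative - f z * f2 z) (at z within {0..})"
    using hderivI[OF d(3)] by simp
qed

lemma has_derivs:
  assumes "z > 0"
  shows "(f has_real_derivative f1 z) (at z)"
    and "(f1 has_real_derivative f2 z) (at z)"
    and "(f2 has_real_derivative - f z * f2 z) (at z)"
  using has_derivs_within[of z] assms by (simp_all add: at_within_halfline)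

lemma continuous_f: "continuous_on {0..} f"
  and continuous_f1: "continuous_on {0..} f1"
  and continuous_f2: "continuous_on {0..} f2"
  using has_derivs_within
  by (auto simp: continuous_on_eq_continuous_within intro: DERIV_continuous)

lemma f_0: "f 0 = 0" and f1_0: "f1 0 = 0" and f1_tendsto: "(f1 \<longlongrightarrow> 1) at_top"
  using blasius by (auto simp: blasius_def)

text \<open>The Blasius equation is linear of first order in \<open>f2\<close>; this is its integrating factor.\<close>

lemma f2_formula:
  assumes "z \<ge> 0"
  shows "f2 z = f2 0 * exp (- integral {0..z} f)"
proof -
  define h where "h t = f2 t * exp (integral {0..t} f)" for t
  have "(h has_real_derivative 0) (at t within {0..z})" if "t \<in> {0..z}" for t
  proof -
    have "((\<lambda>x. integral {0..x} f) has_real_derivative f t) (at t within {0..z})"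
      by (rule integral_has_real_derivative[OF continuous_on_subset[OF continuous_f] that]) auto
    moreover have "(f2 has_real_derivative - f t * f2 t) (at t within {0..z})"
      using has_derivs_within(3)[of t] that by (auto intro: DERIV_subset)
    ultimately show ?thesis
      unfolding h_def by (auto intro!: derivative_eq_intros)
  qed
  then obtain c where "\<And>t. t \<in> {0..z} \<Longrightarrow> h t = c"
    using has_field_derivative_zero_constant[of "{0..z}" h] by auto
  from this[of 0] this[of z] assms have "h z = h 0" by simp
  then show ?thesis
    by (simp add: h_def exp_minus field_simps)
qed

text \<open>By \<open>f2_formula\<close> the sign is that of \<open>f2 0\<close>. Were it nonpositive, \<open>f1\<close> would never exceed its
  initial value \<open>0\<close>, against the limit \<open>1\<close> at infinity.\<close>

lemma f2_pos:
  assumes "z \<ge> 0"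
  shows "f2 z > 0"
proof -
  have "f2 0 > 0"
  proof (rule ccontr)
    assume neg: "\<not> f2 0 > 0"
    have "f1 z \<le> 0" if z: "z > 0" for z
    proof -
      obtain \<xi> where xi: "0 < \<xi>" "f1 z - f1 0 = f2 \<xi> * (z - 0)"
        using halfline_mvt[OF order_refl z continuous_f1 has_derivs(2)] by blast
      have "f2 \<xi> \<le> 0"
        using f2_formula[of \<xi>] neg xi by (simp add: mult_nonpos_nonneg)
      then show ?thesis using xi z f1_0 by (simp add: mult_nonpos_nonneg)
    qed
    then have "eventually (\<lambda>z. f1 z \<le> 0) at_top"
      using eventually_gt_at_top[of 0] by (rule eventually_mono[rotated]) auto
    with f1_tendsto have "1 \<le> (0::real)"
      by (intro tendsto_upperbound[of f1]) auto
    then show False by simp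
  qed
  then show ?thesis
    using f2_formula[OF assms] by simp
qed

lemma f1_strict: "0 \<le> a \<Longrightarrow> a < b \<Longrightarrow> f1 a < f1 b"
  by (rule halfline_mvt[OF _ _ continuous_f1 has_derivs(2), of a b])
     (use f2_pos in \<open>auto intro: mult_pos_pos simp flip: diff_gt_0_iff_gt[of "f1 b"]\<close>)

lemma f1_pos: "0 < z \<Longrightarrow> 0 < f1 z"
  using f1_strict[of 0 z] f1_0 by simp

lemma f1_le_1:
  assumes "z \<ge> 0"
  shows "f1 z \<le> 1"
proof -
  have "eventually (\<lambda>y. f1 z \<le> f1 y) at_top"
    using eventually_gt_at_top[of z]
    by eventually_elim (use assms f1_strict[of z] in \<open>auto intro: less_imp_le\<close>)
  then show ?thesis
    by (intro tendsto_lowerbound[OF f1_tendsto]) auto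
qed

lemma f_strict: "0 \<le> a \<Longrightarrow> a < b \<Longrightarrow> f a < f b"
  by (rule halfline_mvt[OF _ _ continuous_f has_derivs(1), of a b])
     (use f1_pos in \<open>auto intro: mult_pos_pos simp flip: diff_gt_0_iff_gt[of "f b"]\<close>)

lemma f_unbounded: "\<exists>z\<ge>0. y \<le> f z"
proof -
  define c where "c = f1 1"
  have c: "c > 0" by (simp add: c_def f1_pos)
  define z where "z = 1 + (\<bar>y\<bar> + 1) / c"
  have z: "1 < z" using c by (simp add: z_def add_nonneg_pos)
  obtain \<xi> where xi: "1 < \<xi>" "f z - f 1 = f1 \<xi> * (z - 1)"
    using halfline_mvt[OF _ z continuous_f has_derivs(1)] by auto
  have "c * (z - 1) \<le> f1 \<xi> * (z - 1)"
    using xi z f1_strict[of 1 \<xi>] by (intro mult_right_mono) (auto simp: c_def)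
  moreover have "c * (z - 1) = \<bar>y\<bar> + 1" using c by (simp add: z_def)
  moreover have "f 1 > 0" using f_strict[of 0 1] f_0 by simp
  ultimately have "y \<le> f z" using xi by linarith
  then show ?thesis using z by (intro exI[of _ z]) auto
qed

definition Z :: "real \<Rightarrow> real" where
  "Z = inv_into {0..} (\<lambda>z. sqrt 2 * f z)"

lemma Z_inverse: "z \<ge> 0 \<Longrightarrow> Z (sqrt 2 * f z) = z"
proof -
  have "inj_on (\<lambda>z. sqrt 2 * f z) {0..}"
    using f_strict by (intro linorder_inj_onI) (auto simp: less_imp_neq)
  then show "z \<ge> 0 \<Longrightarrow> Z (sqrt 2 * f z) = z"
    unfolding Z_def by (intro inv_into_f_f) auto
qed

lemma Z_range:
  assumes "x \<ge> 0"
  shows "Z x \<ge> 0" and "sqrt 2 * f (Z x) = x"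
proof -
  obtain b where b: "b \<ge> 0" "x / sqrt 2 \<le> f b" using f_unbounded by blast
  have "\<exists>z. 0 \<le> z \<and> z \<le> b \<and> f z = x / sqrt 2"
    by (rule IVT') (use assms b f_0 in \<open>auto intro: continuous_on_subset[OF continuous_f]\<close>)
  then have "x \<in> (\<lambda>z. sqrt 2 * f z) ` {0..}"
    by (auto simp: image_iff field_simps)
  from inv_into_into[OF this] f_inv_into_f[OF this]
  show "Z x \<ge> 0" "sqrt 2 * f (Z x) = x"
    by (simp_all add: Z_def)
qed

lemma Z_0: "Z 0 = 0"
  using Z_inverse[of 0] by (simp add: f_0)

lemma Z_strict:
  assumes "0 \<le> a" "a < b"
  shows "Z a < Z b"
proof (rule ccontr)
  assume "\<not> Z a < Z b"
  then have "f (Z b) \<le> f (Z a)"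
    using f_strict[of "Z b" "Z a"] Z_range(1)[of b] assms by (cases "Z a = Z b") auto
  then have "sqrt 2 * f (Z b) \<le> sqrt 2 * f (Z a)" by simp
  then show False using Z_range(2)[of a] Z_range(2)[of b] assms by simp
qed

lemma Z_tendsto: "filterlim Z at_top at_top"
  unfolding filterlim_at_top
proof
  fix y :: real
  define w where "w = max y 0"
  have w: "w \<ge> 0" "y \<le> w" by (auto simp: w_def)
  have fw: "0 \<le> f w" using f_strict[of 0 w] f_0 w by (cases "w = 0") auto
  show "\<forall>\<^sub>F x in at_top. y \<le> Z x"
    using eventually_gt_at_top[of "sqrt 2 * f w"]
  proof eventually_elim
    case (elim x)
    then show ?case
      using Z_strict[of "sqrt 2 * f w" x] fw w by (simp add: Z_inverse)
  qed
qed

lemma continuous_Z: "continuous_on {0..} Z"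
proof -
  have *: "continuous_on {0..sqrt 2 * f b} Z" if b: "b \<ge> 0" for b
  proof -
    have "continuous_on ((\<lambda>z. sqrt 2 * f z) ` {0..b}) Z"
      by (rule continuous_on_inv)
         (auto intro!: continuous_intros continuous_on_subset[OF continuous_f] simp: Z_inverse)
    moreover have "{0..sqrt 2 * f b} \<subseteq> (\<lambda>z. sqrt 2 * f z) ` {0..b}"
    proof
      fix x assume x: "x \<in> {0..sqrt 2 * f b}"
      have "Z x \<le> b"
      proof (rule ccontr)
        assume "\<not> Z x \<le> b"
        then have "sqrt 2 * f b < sqrt 2 * f (Z x)" using f_strict[of b "Z x"] b by simp
        also have "\<dots> = x" using Z_range(2)[of x] x by simp
        finally show False using x by simp
      qed
      then show "x \<in> (\<lambda>z. sqrt 2 * f z) ` {0..b}"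
        using Z_range[of x] x by (intro image_eqI[of _ _ "Z x"]) auto
    qed
    ultimately show ?thesis by (rule continuous_on_subset)
  qed
  show ?thesis
    unfolding continuous_on_eq_continuous_within
  proof
    fix x :: real assume x: "x \<in> {0..}"
    have *: "continuous_on {0..x + 1} Z"
      using *[of "Z (x + 1)"] Z_range[of "x + 1"] x by simp
    then have "continuous (at x within {0..x + 1}) Z"
      using x by (simp add: continuous_on_eq_continuous_within)
    moreover have "at x within {0..x + 1} = at x within {0..}"
      by (rule at_within_nhd[of _ "{..<x + 1}"]) auto
    ultimately show "continuous (at x within {0..}) Z" by simp
  qed
qed

lemma Z_derivative:
  assumes "x > 0"
  shows "(Z has_real_derivative 1 / (sqrt 2 * f1 (Z x))) (at x)"
proof -
  have Zx: "Z x > 0" using Z_strict[of 0 x] assms by (simp add: Z_0)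
  have "(Z has_real_derivative inverse (sqrt 2 * f1 (Z x))) (at x)"
  proof (rule DERIV_inverse_function[of "\<lambda>z. sqrt 2 * f z" _ _ _ 0 "x + 1"])
    show "((\<lambda>z. sqrt 2 * f z) has_real_derivative sqrt 2 * f1 (Z x)) (at (Z x))"
      using has_derivs(1)[OF Zx] by (auto intro!: derivative_eq_intros)
    show "isCont Z x"
      using continuous_on_interior[OF continuous_Z, of x] assms by (simp add: interior_real_atLeast)
  qed (use assms f1_pos[OF Zx] Z_range(2) in auto)
  then show ?thesis by (simp add: inverse_eq_divide)
qed

text \<open>The streamwise velocity and its wall-normal derivative as functions of the stream function.
  In these variables the Blasius equation becomes a first-order system
  (\<open>velocity_derivative\<close>, \<open>shear_derivative\<close>) from which the inverse function \<open>Z\<close> has disappeared.\<close>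

definition velocity :: "real \<Rightarrow> real" where "velocity x = f1 (Z x)"
definition shear :: "real \<Rightarrow> real" where "shear x = f2 (Z x)"

lemma omega_eq: "omega f x = (velocity x)\<^sup>2"
  by (simp add: omega_def velocity_def Z_def)

lemma Z_nonneg_image: "Z ` {0..} \<subseteq> {0..}"
  using Z_range by auto

lemma continuous_velocity: "continuous_on {0..} velocity"
  and continuous_shear: "continuous_on {0..} shear"
  unfolding velocity_def[abs_def] shear_def[abs_def]
  using continuous_on_compose2[OF continuous_f1 continuous_Z Z_nonneg_image]
    continuous_on_compose2[OF continuous_f2 continuous_Z Z_nonneg_image] by auto

lemma velocity_0: "velocity 0 = 0"
  by (simp add: velocity_def Z_0 f1_0)

lemma velocity_pos: "x > 0 \<Longrightarrow> velocity x > 0"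
  using Z_strict[of 0 x] by (simp add: velocity_def Z_0 f1_pos)

lemma velocity_le_1: "x \<ge> 0 \<Longrightarrow> velocity x \<le> 1"
  using Z_range(1) by (simp add: velocity_def f1_le_1)

lemma velocity_tendsto: "(velocity \<longlongrightarrow> 1) at_top"
  unfolding velocity_def[abs_def] by (rule filterlim_compose[OF f1_tendsto Z_tendsto])

lemma shear_pos: "x \<ge> 0 \<Longrightarrow> shear x > 0"
  using Z_range(1) by (simp add: shear_def f2_pos)

lemma velocity_derivative:
  assumes "x > 0"
  shows "(velocity has_real_derivative shear x / (sqrt 2 * velocity x)) (at x)"
proof -
  have "Z x > 0" using Z_strict[of 0 x] assms by (simp add: Z_0)
  from DERIV_chain2[OF has_derivs(2)[OF this] Z_derivative[OF assms]]
  show ?thesis by (simp add: velocity_def[abs_def] shear_def)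
qed

lemma shear_derivative:
  assumes "x > 0"
  shows "(shear has_real_derivative - x * shear x / (2 * velocity x)) (at x)"
proof -
  have Zx: "Z x > 0" using Z_strict[of 0 x] assms by (simp add: Z_0)
  have "f (Z x) = x / sqrt 2" using Z_range(2)[of x] assms by (simp add: field_simps)
  then have "- f (Z x) * f2 (Z x) * (1 / (sqrt 2 * f1 (Z x))) = - x * f2 (Z x) / (2 * f1 (Z x))"
    by simp
  with DERIV_chain2[OF has_derivs(3)[OF Zx] Z_derivative[OF assms]]
  show ?thesis by (simp add: velocity_def shear_def[abs_def])
qed

lemma shear_antimono:
  assumes "0 \<le> a" "a \<le> b"
  shows "shear b \<le> shear a"
proof (cases "a = b")
  case False
  then obtain \<xi> where xi: "a < \<xi>" "shear b - shear a = - \<xi> * shear \<xi> / (2 * velocity \<xi>) * (b - a)"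
    using halfline_mvt[OF assms(1) _ continuous_shear shear_derivative, of b] assms by auto
  have "0 \<le> \<xi> * shear \<xi> / (2 * velocity \<xi>) * (b - a)"
    using xi assms velocity_pos[of \<xi>] shear_pos[of \<xi>] by simp
  then show ?thesis using xi by simp
qed simp

lemma omega_derivative:
  assumes "x > 0"
  shows "(omega f has_real_derivative sqrt 2 * shear x) (at x)"
proof -
  have "((\<lambda>x. (velocity x)\<^sup>2) has_real_derivative 2 * velocity x * (shear x / (sqrt 2 * velocity x))) (at x)"
    using velocity_derivative[OF assms] by (auto intro!: derivative_eq_intros)
  moreover have "2 * velocity x * (shear x / (sqrt 2 * velocity x)) = sqrt 2 * shear x"
    using velocity_pos[OF assms] by (simp add: field_simps)
  ultimately show ?thesis
    by (simp add: omega_eq[abs_def])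
qed

lemma hderiv_omega: "x > 0 \<Longrightarrow> hderiv (omega f) x = sqrt 2 * shear x"
  by (rule hderiv_eqI_pos[OF _ omega_derivative])

lemma hderiv2_omega:
  assumes "x > 0"
  shows "hderiv (hderiv (omega f)) x = - (sqrt 2 * x * shear x / (2 * velocity x))"
proof (rule hderiv_eqI_pos[OF assms], rule has_field_derivative_transform_within_open)
  show "((\<lambda>x. sqrt 2 * shear x) has_real_derivative - (sqrt 2 * x * shear x / (2 * velocity x))) (at x)"
    using shear_derivative[OF assms] by (auto intro!: derivative_eq_intros)
qed (use assms hderiv_omega in \<open>auto intro: open_greaterThan[of 0]\<close>)

text \<open>Integrating \<open>\<omega>' = sqrt 2 * shear\<close> from the wall, with decreasing shear, bounds
  \<open>\<omega>\<close> below linearly. For \<open>velocity\<close> itself the true order at \<open>0\<close> is the square root; the linear bound,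
  a consequence of \<open>velocity \<le> 1\<close>, avoids fractional powers and is strong enough.\<close>

lemma velocity_ge:
  assumes "0 < x" "x \<le> M"
  shows "shear M * x \<le> (velocity x)\<^sup>2" "shear M * x \<le> velocity x"
proof -
  have cont: "continuous_on {0..} (omega f)"
    unfolding omega_eq[abs_def] by (intro continuous_intros continuous_velocity)
  obtain \<xi> where xi: "0 < \<xi>" "\<xi> < x" "omega f x - omega f 0 = sqrt 2 * shear \<xi> * (x - 0)"
    using halfline_mvt[OF _ assms(1) cont omega_derivative] by auto
  have "1 * shear M * x \<le> sqrt 2 * shear \<xi> * x"
    using xi assms shear_antimono[of \<xi> M] shear_pos[of M] by (intro mult_mono) auto
  then show sq: "shear M * x \<le> (velocity x)\<^sup>2"
    using xi by (simp add: omega_eq velocity_0)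
  have "(velocity x)\<^sup>2 \<le> velocity x"
    using velocity_pos[OF assms(1)] velocity_le_1[of x] assms(1) 
    by (simp add: power2_eq_square mult_le_cancel_right1)
  with sq show "shear M * x \<le> velocity x" by linarith
qed

lemma at_right_0_within: "at_right 0 = at (0::real) within {0..}"
  by (rule at_within_nhd[of _ UNIV]) auto

lemma shear_tendsto_0: "(shear \<longlongrightarrow> shear 0) (at_right 0)"
  using continuous_shear by (auto simp: at_right_0_within continuous_on)

lemma isCont_velocity: "x > 0 \<Longrightarrow> isCont velocity x"
  by (rule DERIV_isCont[OF velocity_derivative])

lemma isCont_shear: "x > 0 \<Longrightarrow> isCont shear x"
  by (rule DERIV_isCont[OF shear_derivative])

text \<open>By \<open>shear_derivative\<close> the exponent in \<open>rho\<close> is the integral of \<open>- (ln shear)'\<close>. The improper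
  form of the fundamental theorem is used since \<open>velocity\<close> vanishes at \<open>0\<close>.\<close>

lemma rho_eq:
  assumes "x > 0"
  shows "rho f x = shear 0 / shear x"
proof -
  have "(LBINT s=ereal 0..ereal x. s / (2 * velocity s)) = - ln (shear x) - (- ln (shear 0))"
  proof (rule interval_integral_FTC_nonneg(2))
    fix s assume s: "ereal 0 < ereal s"
    show "((\<lambda>s. - ln (shear s)) has_real_derivative s / (2 * velocity s)) (at s)"
      using s shear_derivative[of s] shear_pos[of s] velocity_pos[of s]
      by (auto intro!: derivative_eq_intros simp: field_simps)
    show "isCont (\<lambda>s. s / (2 * velocity s)) s"
      using s velocity_pos[of s] by (auto intro!: continuous_intros isCont_velocity)
  next
    show "AE s in lborel. ereal 0 < ereal s \<longrightarrow> ereal s < ereal x \<longrightarrow> 0 \<le> s / (2 * velocity s)"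
      using velocity_pos by (intro AE_I2) (auto intro!: divide_nonneg_nonneg simp: less_imp_le)
    have "((\<lambda>s. - ln (shear s)) \<longlongrightarrow> - ln (shear 0)) (at_right 0)"
      using shear_pos[of 0] by (intro tendsto_intros shear_tendsto_0) auto
    then show "(((\<lambda>s. - ln (shear s)) \<circ> real_of_ereal) \<longlongrightarrow> - ln (shear 0)) (at_right (ereal 0))"
      by (simp add: ereal_tendsto_simps del: zero_ereal_def)
    have "((\<lambda>s. - ln (shear s)) \<longlongrightarrow> - ln (shear x)) (at x)"
      using shear_pos[of x] assms isCont_shear[OF assms] by (intro tendsto_intros) (auto simp: isCont_def)
    then have "((\<lambda>s. - ln (shear s)) \<longlongrightarrow> - ln (shear x)) (at_left x)"
      by (rule tendsto_mono[rotated]) (simp add: at_le)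
    then show "(((\<lambda>s. - ln (shear s)) \<circ> real_of_ereal) \<longlongrightarrow> - ln (shear x)) (at_left (ereal x))"
      by (simp add: ereal_tendsto_simps)
  qed (use assms in auto)
  moreover have "(LBINT s=ereal 0..ereal x. s / (2 * velocity s)) = (LBINT s:{0..x}. s / (2 * sqrt (omega f s)))"
  proof -
    have "(LBINT s=ereal 0..ereal x. s / (2 * velocity s)) = (LBINT s:{0..x}. s / (2 * velocity s))"
      by (rule interval_integral_Icc) (use assms in auto)
    also have "\<dots> = (LBINT s:{0..x}. s / (2 * sqrt (omega f s)))"
    proof (rule set_lebesgue_integral_cong)
      show "\<forall>s. s \<in> {0..x} \<longrightarrow> s / (2 * velocity s) = s / (2 * sqrt (omega f s))"
      proof (intro allI impI)
        fix s assume "s \<in> {0..x}"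
        then show "s / (2 * velocity s) = s / (2 * sqrt (omega f s))"
          using velocity_pos[of s] by (cases "s = 0") (auto simp: omega_eq)
      qed
    qed auto
    finally show ?thesis .
  qed
  ultimately have "rho f x = exp (ln (shear 0) - ln (shear x))"
    by (simp add: rho_def)
  then show ?thesis
    using shear_pos[of 0] shear_pos[of x] assms by (simp add: exp_diff)
qed

lemma weight_A_eq: "x > 0 \<Longrightarrow> weight_A f x = shear 0 / (shear x * velocity x)"
  using velocity_pos[of x] by (simp add: weight_A_def rho_eq omega_eq)

text \<open>Up to the factor \<open>sqrt 2\<close> the integrand is the derivative of \<open>\<omega>\<close>, which rises from \<open>0\<close> to
  \<open>1\<close>.\<close>

lemma shear_integrable: "set_integrable lborel {0<..} shear"
proof -
  have cont: "continuous_on {0..} (omega f)"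
    unfolding omega_eq[abs_def] by (intro continuous_intros continuous_velocity)
  have "set_integrable lborel (einterval (ereal 0) \<infinity>) (\<lambda>x. sqrt 2 * shear x)"
  proof (rule interval_integral_FTC_nonneg(1))
    show "AE x in lborel. ereal 0 < ereal x \<longrightarrow> ereal x < \<infinity> \<longrightarrow> 0 \<le> sqrt 2 * shear x"
      using shear_pos by (intro AE_I2) (auto simp: less_imp_le)
    have "(omega f \<longlongrightarrow> omega f 0) (at_right 0)"
      using cont by (auto simp: at_right_0_within continuous_on)
    then show "((omega f \<circ> real_of_ereal) \<longlongrightarrow> omega f 0) (at_right (ereal 0))"
      by (simp add: ereal_tendsto_simps)
    have "(omega f \<longlongrightarrow> 1\<^sup>2) at_top"
      unfolding omega_eq[abs_def] by (intro tendsto_intros velocity_tendsto)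
    then show "((omega f \<circ> real_of_ereal) \<longlongrightarrow> 1\<^sup>2) (at_left \<infinity>)"
      by (simp add: ereal_tendsto_simps)
  qed (auto intro!: continuous_intros isCont_shear omega_derivative)
  then have "set_integrable lborel {0<..} (\<lambda>x. (1 / sqrt 2) * (sqrt 2 * shear x))"
    unfolding einterval_eq by (rule set_integrable_mult_right)
  moreover have "(1 / sqrt 2) * (sqrt 2 * shear x) = shear x" for x
    by simp
  ultimately show ?thesis by (simp only:)
qed

end

section \<open>The eigenfunction\<close>

context blasius_flow
begin

text \<open>\<open>eigf\<close> is \<open>x * hderiv (omega f) x\<close> in closed form (\<open>eigf_eq\<close>), and \<open>kappa\<close> its logarithmic
  derivative (\<open>eigf_derivative\<close>).\<close>

definition eigf :: "real \<Rightarrow> real" where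
  "eigf x = sqrt 2 * x * shear x"

definition kappa :: "real \<Rightarrow> real" where
  "kappa x = 1 / x - x / (2 * velocity x)"

definition kappa' :: "real \<Rightarrow> real" where
  "kappa' x = - 1 / x\<^sup>2 - 1 / (2 * velocity x) + x * shear x / (2 * sqrt 2 * velocity x ^ 3)"

lemma eigf_eq: "x \<ge> 0 \<Longrightarrow> x * hderiv (omega f) x = eigf x"
  using hderiv_omega[of x] by (cases "x = 0") (auto simp: eigf_def)

lemma eigf_derivative:
  assumes "x > 0"
  shows "(eigf has_real_derivative kappa x * eigf x) (at x)"
  unfolding eigf_def[abs_def]
  by (rule derivative_eq_intros refl shear_derivative[OF assms])+
     (use assms velocity_pos[OF assms] in \<open>simp add: kappa_def field_simps\<close>)

lemma kappa_derivative:
  assumes "x > 0"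
  shows "(kappa has_real_derivative kappa' x) (at x)"
proof -
  have u: "velocity x > 0" by (rule velocity_pos[OF assms])
  have "(kappa has_real_derivative (- 1 / x\<^sup>2 -
      (2 * velocity x - x * (2 * (shear x / (sqrt 2 * velocity x)))) / (2 * velocity x)\<^sup>2)) (at x)"
    unfolding kappa_def[abs_def]
    using assms u
    by (auto intro!: derivative_eq_intros velocity_derivative simp: power2_eq_square)
  also have "- 1 / x\<^sup>2 - (2 * velocity x - x * (2 * (shear x / (sqrt 2 * velocity x)))) / (2 * velocity x)\<^sup>2
     = kappa' x"
    unfolding kappa'_def using assms u
    by (simp add: power2_eq_square power3_eq_cube diff_divide_distrib mult.assoc)
  finally show ?thesis .
qed

text \<open>The logarithmic derivative of a solution of a linear second-order equation solves the
  associated Riccati equation; this one encodes that \<open>eigf\<close> has eigenvalue \<open>1\<close>.\<close>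

lemma kappa_riccati:
  assumes "x > 0"
  shows "kappa' x + kappa x * (x / (2 * velocity x)) + (kappa x)\<^sup>2
    = sqrt 2 * x * shear x / (4 * velocity x ^ 3) - 1 / velocity x"
proof -
  have u: "velocity x > 0" by (rule velocity_pos[OF assms])
  have s: "1 / sqrt 2 = sqrt 2 / 2" by (simp add: real_div_sqrt)
  have "x * shear x / (2 * sqrt 2 * velocity x ^ 3) = (1 / sqrt 2) * (x * shear x / (2 * velocity x ^ 3))"
    by simp
  also have "\<dots> = sqrt 2 * x * shear x / (4 * velocity x ^ 3)"
    unfolding s by simp
  finally have "kappa' x = - 1 / x\<^sup>2 - 1 / (2 * velocity x) + sqrt 2 * x * shear x / (4 * velocity x ^ 3)"
    by (simp add: kappa'_def)
  moreover have "- 1 / x\<^sup>2 - 1 / (2 * velocity x) + kappa x * (x / (2 * velocity x)) + (kappa x)\<^sup>2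
      = - 1 / velocity x"
    using assms u by (simp add: kappa_def power2_eq_square field_simps)
  ultimately show ?thesis by simp
qed

lemma continuous_eigf: "continuous_on {0..} eigf"
  unfolding eigf_def[abs_def] by (intro continuous_intros continuous_shear)

lemma eigenfunction: "is_eigenfunction f 1 (\<lambda>x. x * hderiv (omega f) x)"
proof -
  let ?v = "\<lambda>x. x * hderiv (omega f) x"
  have v: "(?v has_real_derivative kappa x * eigf x) (at x)" if "x > 0" for x
    by (rule has_field_derivative_transform_within_open[OF eigf_derivative[OF that] open_greaterThan[of 0]])
       (use that eigf_eq in auto)
  have v': "hderiv ?v x = kappa x * eigf x" if "x > 0" for x
    by (rule hderiv_eqI_pos[OF that v[OF that]])
  have v2: "(hderiv ?v has_real_derivative (kappa' x + (kappa x)\<^sup>2) * eigf x) (at x)" if "x > 0" for x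
  proof (rule has_field_derivative_transform_within_open[OF _ open_greaterThan[of 0]])
    show "((\<lambda>x. kappa x * eigf x) has_real_derivative (kappa' x + (kappa x)\<^sup>2) * eigf x) (at x)"
      by (rule derivative_eq_intros eigf_derivative[OF that] kappa_derivative[OF that])+
         (simp add: algebra_simps power2_eq_square)
  qed (use that v' in auto)
  have v'': "hderiv (hderiv ?v) x = (kappa' x + (kappa x)\<^sup>2) * eigf x" if "x > 0" for x
    by (rule hderiv_eqI_pos[OF that v2[OF that]])
  have "op_L f ?v x = 1 * ?v x" if x: "x > 0" for x
  proof -
    have u: "velocity x > 0" by (rule velocity_pos[OF x])
    have k: "kappa' x + (kappa x)\<^sup>2 = sqrt 2 * x * shear x / (4 * velocity x ^ 3) - 1 / velocity x
        - kappa x * (x / (2 * velocity x))"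
      using kappa_riccati[OF x] by linarith
    have w: "sqrt (omega f x) = velocity x" using u by (simp add: omega_eq)
    have "op_L f ?v x = eigf x * (- x * kappa x / 2 - velocity x * (kappa' x + (kappa x)\<^sup>2)
       + (sqrt 2 * x * shear x / (2 * velocity x)) / (2 * velocity x))"
      using x by (simp add: op_L_def v' v'' w hderiv2_omega eigf_eq algebra_simps)
    also have "- x * kappa x / 2 - velocity x * (kappa' x + (kappa x)\<^sup>2)
       + (sqrt 2 * x * shear x / (2 * velocity x)) / (2 * velocity x) = 1"
      unfolding k using u by (simp add: right_diff_distrib power3_eq_cube)
    finally show ?thesis using x by (simp add: eigf_eq)
  qed
  moreover have "continuous_on {0..} ?v"
    by (rule continuous_on_eq[OF continuous_eigf]) (simp add: eigf_eq)
  moreover have "?v differentiable (at x) \<and> hderiv ?v differentiable (at x)" if "x > 0" for x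
    using v[OF that] v2[OF that] by (auto simp: real_differentiable_def)
  moreover have "?v 1 \<noteq> 0"
    using shear_pos[of 1] by (simp add: hderiv_omega)
  ultimately show ?thesis
    unfolding is_eigenfunction_def by (auto intro!: exI[of _ 1])
qed

section \<open>The ground-state identity\<close>

text \<open>\<open>energy\<close> and \<open>mass\<close> are the integrands of the Rayleigh quotient written through \<open>velocity\<close>
  and \<open>shear\<close> (\<open>rayleigh_eq\<close>). With \<open>v = eigf * w\<close> one has
  \<open>hderiv v - kappa * v = eigf * hderiv w\<close>, so \<open>defect\<close> measures how far \<open>v\<close> is from a multiple of
  the eigenfunction.\<close>

definition pot :: "real \<Rightarrow> real" where
  "pot x = sqrt 2 * x * shear x / (4 * velocity x ^ 3)"

definition energy :: "(real \<Rightarrow> real) \<Rightarrow> real \<Rightarrow> real" where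
  "energy v x = shear 0 / shear x * ((hderiv v x)\<^sup>2 + pot x * (v x)\<^sup>2)"

definition mass :: "(real \<Rightarrow> real) \<Rightarrow> real \<Rightarrow> real" where
  "mass v x = shear 0 / shear x * (1 / velocity x * (v x)\<^sup>2)"

definition defect :: "(real \<Rightarrow> real) \<Rightarrow> real \<Rightarrow> real" where
  "defect v x = shear 0 / shear x * (hderiv v x - kappa x * v x)\<^sup>2"

lemma defect_nonneg: "x > 0 \<Longrightarrow> 0 \<le> defect v x"
  using shear_pos[of 0] shear_pos[of x] by (simp add: defect_def)

lemma defect_integral_nonneg: "0 \<le> (LBINT x:{0<..}. defect v x)"
  unfolding set_lebesgue_integral_def
  by (rule Bochner_Integration.integral_nonneg) (auto simp: indicator_def defect_nonneg)

lemma rayleigh_eq: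
  "rayleigh f v = (LBINT x:{0<..}. energy v x) / (LBINT x:{0<..}. mass v x)"
proof -
  have "(LBINT x:{0<..}. rho f x * (hderiv v x)\<^sup>2
        - hderiv (hderiv (omega f)) x / (2 * sqrt (omega f x)) * weight_A f x * (v x)\<^sup>2)
      = (LBINT x:{0<..}. energy v x)"
  proof (rule set_lebesgue_integral_cong, simp, intro allI impI)
    fix x :: real assume "x \<in> {0<..}"
    then have x: "x > 0" by simp
    then show "rho f x * (hderiv v x)\<^sup>2
        - hderiv (hderiv (omega f)) x / (2 * sqrt (omega f x)) * weight_A f x * (v x)\<^sup>2 = energy v x"
      using velocity_pos[OF x] shear_pos[of x]
      by (simp add: rho_eq weight_A_eq hderiv2_omega omega_eq energy_def pot_def power3_eq_cube
          ring_distribs mult_ac)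
  qed
  moreover have "(LBINT x:{0<..}. weight_A f x * (v x)\<^sup>2) = (LBINT x:{0<..}. mass v x)"
    by (rule set_lebesgue_integral_cong) (auto simp: weight_A_eq mass_def)
  ultimately show ?thesis unfolding rayleigh_def by simp
qed

text \<open>Jacobi's completion of the square: after expanding the square in \<open>defect\<close>, the coefficient
  of \<open>(v x)\<^sup>2\<close> vanishes by the Riccati equation and what remains is an exact derivative.\<close>

lemma energy_identity:
  assumes x: "x > 0" and v: "(v has_real_derivative hderiv v x) (at x)"
  shows "((\<lambda>x. shear 0 / shear x * (kappa x * (v x)\<^sup>2)) has_real_derivative
    energy v x - mass v x - defect v x) (at x)"
proof -
  have u: "velocity x > 0" and t: "shear x > 0" using x velocity_pos shear_pos by auto
  have "((\<lambda>x. shear 0 / shear x) has_real_derivative shear 0 / shear x * (x / (2 * velocity x))) (at x)"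
    using u t by (auto intro!: derivative_eq_intros shear_derivative[OF x] simp: power2_eq_square)
  moreover have "((\<lambda>x. kappa x * (v x)\<^sup>2) has_real_derivative
      kappa' x * (v x)\<^sup>2 + 2 * kappa x * v x * hderiv v x) (at x)"
    by (auto intro!: derivative_eq_intros kappa_derivative[OF x] v)
  ultimately have "((\<lambda>x. shear 0 / shear x * (kappa x * (v x)\<^sup>2)) has_real_derivative
     shear 0 / shear x * (x / (2 * velocity x)) * (kappa x * (v x)\<^sup>2) +
     (kappa' x * (v x)\<^sup>2 + 2 * kappa x * v x * hderiv v x) * (shear 0 / shear x)) (at x)"
    by (rule DERIV_mult)
  also have "shear 0 / shear x * (x / (2 * velocity x)) * (kappa x * (v x)\<^sup>2) +
      (kappa' x * (v x)\<^sup>2 + 2 * kappa x * v x * hderiv v x) * (shear 0 / shear x) =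
     shear 0 / shear x * ((kappa' x + kappa x * (x / (2 * velocity x))) * (v x)\<^sup>2
       + 2 * kappa x * v x * hderiv v x)"
    by (simp only: ring_distribs mult_ac)
  finally have "((\<lambda>x. shear 0 / shear x * (kappa x * (v x)\<^sup>2)) has_real_derivative
     shear 0 / shear x * ((kappa' x + kappa x * (x / (2 * velocity x))) * (v x)\<^sup>2
       + 2 * kappa x * v x * hderiv v x)) (at x)" .
  moreover have "kappa' x + kappa x * (x / (2 * velocity x)) = pot x - 1 / velocity x - (kappa x)\<^sup>2"
    using kappa_riccati[OF x] by (simp add: pot_def)
  moreover have "shear 0 / shear x * ((pot x - 1 / velocity x - (kappa x)\<^sup>2) * (v x)\<^sup>2
       + 2 * kappa x * v x * hderiv v x) = energy v x - mass v x - defect v x"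
    unfolding energy_def mass_def defect_def by (simp add: power2_eq_square algebra_simps)
  ultimately show ?thesis by simp
qed

lemma continuous_coeffs:
  shows "continuous_on {0<..} velocity" "continuous_on {0<..} shear" "continuous_on {0<..} kappa"
  using isCont_velocity isCont_shear DERIV_isCont[OF kappa_derivative]
  by (auto intro: continuous_at_imp_continuous_on)

end

lemma bounded_imageI:
  fixes g :: "'a \<Rightarrow> real"
  assumes "\<And>x. x \<in> S \<Longrightarrow> \<bar>g x\<bar> \<le> C"
  shows "bounded (g ` S)"
  using assms unfolding bounded_iff by (intro exI[of _ C]) auto

lemma bounded_image_const: "bounded ((\<lambda>x. c :: real) ` S)"
  by (rule bounded_imageI[of _ _ "\<bar>c\<bar>"]) simp

lemma bounded_image_cong:
  "bounded (g ` S) \<Longrightarrow> (\<And>x. x \<in> S \<Longrightarrow> g x = h x) \<Longrightarrow> bounded (h ` S)"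
  by (metis image_cong)

lemma bounded_image_mult:
  fixes g h :: "'a \<Rightarrow> real"
  assumes "bounded (g ` S)" "bounded (h ` S)"
  shows "bounded ((\<lambda>x. g x * h x) ` S)"
proof -
  obtain a b where "\<And>x. x \<in> S \<Longrightarrow> \<bar>g x\<bar> \<le> a" "\<And>x. x \<in> S \<Longrightarrow> \<bar>h x\<bar> \<le> b"
    using assms unfolding bounded_iff by auto
  then have "\<bar>g x * h x\<bar> \<le> a * b" if "x \<in> S" for x
    using that unfolding abs_mult by (intro mult_mono') auto
  then show ?thesis by (rule bounded_imageI)
qed

lemma Cc_infinity_properties:
  assumes v: "v \<in> Cc_infinity" "v 0 = 0"
  obtains M where "M > 0"
    "\<And>x. x > 0 \<Longrightarrow> (v has_real_derivative hderiv v x) (at x)"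
    "continuous_on {0<..} v" "continuous_on {0<..} (hderiv v)"
    "bounded ((\<lambda>x. v x / x) ` {0<..M})" "bounded (hderiv v ` {0<..M})"
    "\<And>x. M < x \<Longrightarrow> v x = 0 \<and> hderiv v x = 0"
proof -
  have diff: "(hderiv ^^ k) v differentiable (at x within {0..})" if "x \<ge> 0" for k x
    using v that by (auto simp: Cc_infinity_def)
  have d: "(v has_real_derivative hderiv v x) (at x within {0..})" if "x \<ge> 0" for x
    using diff[OF that, of 0] by (auto intro: hderivI)
  then have d_pos: "(v has_real_derivative hderiv v x) (at x)" if "x > 0" for x
    using that d[of x] by (simp add: at_within_halfline)
  have cont: "continuous_on {0..} v"
    using d by (auto simp: continuous_on_eq_continuous_within intro: DERIV_continuous)
  have cont': "continuous_on {0..} (hderiv v)"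
    using diff[of _ 1]
    by (auto simp: continuous_on_eq_continuous_within intro: differentiable_imp_continuous_within)
  have "bounded {x. x \<ge> 0 \<and> v x \<noteq> 0}"
    using v by (simp add: Cc_infinity_def)
  then obtain B where B: "\<And>x. x \<ge> 0 \<Longrightarrow> v x \<noteq> 0 \<Longrightarrow> \<bar>x\<bar> \<le> B"
    unfolding bounded_iff by auto
  define M where "M = \<bar>B\<bar> + 1"
  have M: "M > 0" by (simp add: M_def)
  have v0: "v x = 0" if "M < x" for x
    using B[of x] that M by (cases "v x = 0") (auto simp: M_def)
  have v'0: "hderiv v x = 0" if "M < x" for x
  proof (rule hderiv_eqI_pos)
    show "(v has_real_derivative 0) (at x)"
      by (rule has_field_derivative_transform_within_open[of "\<lambda>_. 0" _ _ "{M<..}"])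
         (use that v0 in auto)
  qed (use M that in auto)
  have "compact (hderiv v ` {0..M})"
    by (intro compact_continuous_image continuous_on_subset[OF cont']) auto
  then have "bounded (hderiv v ` {0..M})" by (rule compact_imp_bounded)
  then obtain C where "\<forall>x\<in>{0..M}. \<bar>hderiv v x\<bar> \<le> C"
    unfolding bounded_iff by auto
  then have C: "\<bar>hderiv v x\<bar> \<le> C" if "x \<in> {0..M}" for x
    using that by blast
  have "\<bar>v x / x\<bar> \<le> C" if x: "x \<in> {0<..M}" for x
  proof -
    obtain \<xi> where "0 < \<xi>" "\<xi> < x" "v x - v 0 = hderiv v \<xi> * (x - 0)"
      using halfline_mvt[OF order_refl _ cont d_pos, of x] x by auto
    then show ?thesis
      using x C[of \<xi>] v(2) by (simp add: abs_mult)
  qed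
  then have "bounded ((\<lambda>x. v x / x) ` {0<..M})" by (rule bounded_imageI)
  moreover have "bounded (hderiv v ` {0<..M})"
    by (rule bounded_imageI[OF C]) auto
  moreover have "continuous_on {0<..} v" "continuous_on {0<..} (hderiv v)"
    by (auto intro: continuous_on_subset[OF cont] continuous_on_subset[OF cont'])
  ultimately show thesis
    using that[OF M d_pos] v0 v'0 by simp
qed

context blasius_flow
begin

text \<open>The singular coefficients become bounded once each \<open>1 / velocity\<close> or \<open>1 / (velocity)\<^sup>2\<close> is
  paired with one factor \<open>x\<close>, as \<open>velocity_ge\<close> allows. A test function supplies two such factors
  through \<open>(v x)\<^sup>2\<close>, and \<open>pot\<close> brings a third.\<close>

lemma bounded_coeffs:
  assumes M: "M > 0"
  shows "bounded ((\<lambda>x. x) ` {0<..M})" "bounded (shear ` {0<..M})"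
    "bounded ((\<lambda>x. shear 0 / shear x) ` {0<..M})"
    "bounded ((\<lambda>x. x / velocity x) ` {0<..M})"
    "bounded ((\<lambda>x. x / (velocity x)\<^sup>2) ` {0<..M})"
    "bounded ((\<lambda>x. x * kappa x) ` {0<..M})"
proof -
  have m: "shear M > 0" using M shear_pos by simp
  show x: "bounded ((\<lambda>x. x) ` {0<..M})" by (rule bounded_imageI[of _ _ M]) auto
  show "bounded (shear ` {0<..M})"
  proof (rule bounded_imageI)
    show "\<bar>shear x\<bar> \<le> shear 0" if "x \<in> {0<..M}" for x
      using that shear_pos[of x] shear_antimono[of 0 x] by auto
  qed
  have "\<bar>shear 0 / shear x\<bar> \<le> shear 0 / shear M" if "x \<in> {0<..M}" for x
  proof -
    have "shear M \<le> shear x" "0 < shear x" "0 < shear 0"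
      using that shear_pos shear_antimono[of x M] by auto
    then show ?thesis using m by (simp add: frac_le)
  qed
  then show "bounded ((\<lambda>x. shear 0 / shear x) ` {0<..M})"
    by (rule bounded_imageI)
  have "\<bar>x / velocity x\<bar> \<le> 1 / shear M \<and> \<bar>x / (velocity x)\<^sup>2\<bar> \<le> 1 / shear M" if "x \<in> {0<..M}" for x
    using velocity_ge[of x M] velocity_pos[of x] m that by (simp add: field_simps)
  then show u: "bounded ((\<lambda>x. x / velocity x) ` {0<..M})"
    "bounded ((\<lambda>x. x / (velocity x)\<^sup>2) ` {0<..M})"
    by (auto intro!: bounded_imageI[of _ _ "1 / shear M"])
  have "bounded ((\<lambda>x. 1 - (1 / 2) * (x * (x / velocity x))) ` {0<..M})"
    by (intro bounded_minus_comp bounded_image_mult bounded_image_const x u)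
  moreover have "1 - (1 / 2) * (x * (x / velocity x)) = x * kappa x" if "x \<in> {0<..M}" for x
    using that velocity_pos[of x] by (simp add: kappa_def right_diff_distrib)
  ultimately show "bounded ((\<lambda>x. x * kappa x) ` {0<..M})"
    by (rule bounded_image_cong)
qed

text \<open>Integration of \<open>energy_identity\<close>. The boundary term vanishes at infinity because \<open>v\<close> has
  compact support, and at \<open>0\<close> because \<open>kappa * v\<close> and \<open>v x / x\<close> are bounded there, so that it is
  \<open>O(x)\<close>.\<close>

lemma ground_state_identity:
  assumes v: "v \<in> Cc_infinity" "v 0 = 0"
  shows "set_integrable lborel {0<..} (mass v)" and "set_integrable lborel {0<..} (defect v)"
    and "(LBINT x:{0<..}. energy v x) = (LBINT x:{0<..}. mass v x) + (LBINT x:{0<..}. defect v x)"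
    and "continuous_on {0<..} (mass v)"
proof -
  obtain M where M: "M > 0"
    and d: "\<And>x. x > 0 \<Longrightarrow> (v has_real_derivative hderiv v x) (at x)"
    and c: "continuous_on {0<..} v" "continuous_on {0<..} (hderiv v)"
    and b: "bounded ((\<lambda>x. v x / x) ` {0<..M})" "bounded (hderiv v ` {0<..M})"
    and z: "\<And>x. M < x \<Longrightarrow> v x = 0 \<and> hderiv v x = 0"
    by (rule Cc_infinity_properties[OF v]) (rule that, simp_all)
  note B = bounded_coeffs[OF M]
  have nz: "velocity x \<noteq> 0" "shear x \<noteq> 0" if "x > 0" for x
    using velocity_pos[of x] shear_pos[of x] that by auto
  have ce: "continuous_on {0<..} (energy v)" and cm: "continuous_on {0<..} (mass v)"
    and cd: "continuous_on {0<..} (defect v)"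
    unfolding energy_def[abs_def] mass_def[abs_def] defect_def[abs_def] pot_def
    by (intro continuous_intros c continuous_coeffs; auto simp: nz)+
  \<comment> \<open>The three integrands and the boundary term are products of the bounded quantities in \<open>B\<close>,
    \<open>b\<close> and \<open>kv\<close>.\<close>
  have kv: "bounded ((\<lambda>x. kappa x * v x) ` {0<..M})"
  proof -
    have "bounded ((\<lambda>x. x * kappa x * (v x / x)) ` {0<..M})"
      by (intro bounded_image_mult B b)
    moreover have "x * kappa x * (v x / x) = kappa x * v x" if "x \<in> {0<..M}" for x
      using that by simp
    ultimately show ?thesis by (rule bounded_image_cong)
  qed
  have be: "bounded (energy v ` {0<..M})"
  proof -
    have "bounded ((\<lambda>x. shear 0 / shear x * (hderiv v x * hderiv v x +
        sqrt 2 / 4 * (x / velocity x * (x / (velocity x)\<^sup>2) * (v x / x * (v x / x)) * shear x * x))) ` {0<..M})"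
      by (intro bounded_image_mult bounded_plus_comp bounded_image_const B b)
    moreover have "shear 0 / shear x * (hderiv v x * hderiv v x +
        sqrt 2 / 4 * (x / velocity x * (x / (velocity x)\<^sup>2) * (v x / x * (v x / x)) * shear x * x))
      = energy v x" if "x \<in> {0<..M}" for x
      using that nz by (simp add: energy_def pot_def power2_eq_square power3_eq_cube mult_ac)
    ultimately show ?thesis by (rule bounded_image_cong)
  qed
  have bm: "bounded (mass v ` {0<..M})"
  proof -
    have "bounded ((\<lambda>x. shear 0 / shear x * (x / velocity x * (v x / x * (v x / x) * x))) ` {0<..M})"
      by (intro bounded_image_mult B b)
    moreover have "shear 0 / shear x * (x / velocity x * (v x / x * (v x / x) * x)) = mass v x"
      if "x \<in> {0<..M}" for x
      using that nz by (simp add: mass_def power2_eq_square)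
    ultimately show ?thesis by (rule bounded_image_cong)
  qed
  have bd: "bounded (defect v ` {0<..M})"
    unfolding defect_def[abs_def] power2_eq_square
    by (intro bounded_image_mult bounded_minus_comp B b kv)
  have ie: "set_integrable lborel {0<..} (energy v)"
    by (rule set_integrable_halfline[OF ce be]) (simp add: energy_def z)
  show im: "set_integrable lborel {0<..} (mass v)"
    by (rule set_integrable_halfline[OF cm bm]) (simp add: mass_def z)
  show id: "set_integrable lborel {0<..} (defect v)"
    by (rule set_integrable_halfline[OF cd bd]) (simp add: defect_def z)
  have "(LBINT x:{0<..}. energy v x - mass v x - defect v x) = 0 - 0"
  proof (rule set_integral_halfline_FTC)
    show "continuous_on {0<..} (\<lambda>x. energy v x - mass v x - defect v x)"
      by (intro continuous_intros ce cm cd)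
    show "set_integrable lborel {0<..} (\<lambda>x. energy v x - mass v x - defect v x)"
      by (intro set_integral_diff ie im id)
    have "bounded ((\<lambda>x. shear 0 / shear x * (kappa x * v x * (v x / x))) ` {0<..M})"
      by (intro bounded_image_mult B b kv)
    then obtain K where K: "\<forall>x\<in>{0<..M}. \<bar>shear 0 / shear x * (kappa x * v x * (v x / x))\<bar> \<le> K"
      by (auto simp: bounded_iff)
    show "((\<lambda>x. shear 0 / shear x * (kappa x * (v x)\<^sup>2)) \<longlongrightarrow> 0) (at_right 0)"
    proof (rule Lim_null_comparison)
      show "\<forall>\<^sub>F x in at_right 0. norm (shear 0 / shear x * (kappa x * (v x)\<^sup>2)) \<le> K * x"
        unfolding eventually_at_right_field
      proof (intro exI[of _ M] conjI M allI impI)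
        fix x :: real assume x: "0 < x" "x < M"
        define b where "b = shear 0 / shear x * (kappa x * v x * (v x / x))"
        have "shear 0 / shear x * (kappa x * (v x)\<^sup>2) = b * x"
          using x by (simp add: b_def power2_eq_square)
        moreover have "\<bar>b\<bar> \<le> K" using K x by (simp add: b_def)
        ultimately show "norm (shear 0 / shear x * (kappa x * (v x)\<^sup>2)) \<le> K * x"
          using x by (simp only: real_norm_def abs_mult) (simp add: mult_right_mono)
      qed
      show "((\<lambda>x. K * x) \<longlongrightarrow> 0) (at_right 0)"
        by (intro tendsto_mult_right_zero tendsto_ident_at)
    qed
    show "((\<lambda>x. shear 0 / shear x * (kappa x * (v x)\<^sup>2)) \<longlongrightarrow> 0) at_top"
      by (rule tendsto_eventually) (use eventually_gt_at_top[of M] in eventually_elim, simp add: z)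
  qed (use energy_identity d in auto)
  moreover have "(LBINT x:{0<..}. energy v x - mass v x - defect v x) =
      (LBINT x:{0<..}. energy v x) - (LBINT x:{0<..}. mass v x) - (LBINT x:{0<..}. defect v x)"
    using ie im id set_integral_diff(1)[OF ie im] by (simp add: set_integral_diff(2))
  ultimately show "(LBINT x:{0<..}. energy v x) = (LBINT x:{0<..}. mass v x) + (LBINT x:{0<..}. defect v x)"
    by linarith
  show "continuous_on {0<..} (mass v)" by (rule cm)
qed

lemma rayleigh_ge_1:
  assumes v: "v \<in> Cc_infinity" "v 0 = 0" and nz: "\<exists>x\<ge>0. v x \<noteq> 0"
  shows "1 \<le> rayleigh f v"
proof -
  note G = ground_state_identity[OF v]
  obtain x0 where x0: "x0 > 0" "v x0 \<noteq> 0"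
    using nz v(2) by (metis less_eq_real_def)
  have "0 < (LBINT x:{0<..}. mass v x)"
  proof (rule set_integral_halfline_pos[OF G(1) _ G(4) x0(1)])
    show "0 \<le> mass v x" if "0 < x" for x
      using that shear_pos[of 0] shear_pos[of x] velocity_pos[of x] by (simp add: mass_def)
    show "0 < mass v x0"
      using x0 shear_pos[of 0] shear_pos[of x0] velocity_pos[of x0] by (simp add: mass_def)
  qed
  moreover have "0 \<le> (LBINT x:{0<..}. defect v x)" by (rule defect_integral_nonneg)
  ultimately show ?thesis
    unfolding rayleigh_eq G(3) by simp
qed

end

section \<open>Near-minimisers\<close>

context blasius_flow
begin

lemma openin_pos: "openin (top_of_set {0..}) ({0<..} :: real set)"
proof -
  have "{0..} \<inter> {0<..} = ({0<..} :: real set)" by auto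
  then show ?thesis
    using openin_open_Int[of "{0<..}" "{0 :: real..}"] by simp
qed

text \<open>The derivatives of the two functions are rational expressions in \<open>x\<close> and the functions
  themselves, so each order of differentiability yields the next.\<close>

lemma diff_order_velocity_shear:
  "diff_order n {0<..} velocity \<and> diff_order n {0<..} shear"
proof (induction n)
  case (Suc n)
  have nz: "velocity x \<noteq> 0" if "x \<in> {0<..}" for x
    using velocity_pos[of x] that by auto
  have ratio: "diff_order n {0<..} (\<lambda>x. shear x * inverse (velocity x))"
    using Suc by (intro diff_order_mult[OF openin_pos] diff_order_inverse[OF openin_pos nz]) auto
  have prod: "diff_order n {0<..} (\<lambda>x. x * (shear x * inverse (velocity x)))"
    by (rule diff_order_mult[OF openin_pos diff_order_id[OF openin_pos] ratio])
  have "diff_order (Suc n) {0<..} velocity"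
  proof (rule diff_order_SucI[OF openin_pos])
    show "diff_order n {0<..} (\<lambda>x. 1 / sqrt 2 * (shear x * inverse (velocity x)))"
      by (rule diff_order_mult[OF openin_pos diff_order_const[OF openin_pos] ratio])
    show "(velocity has_real_derivative 1 / sqrt 2 * (shear x * inverse (velocity x))) (at x within {0..})"
      if "x \<in> {0<..}" for x
      using velocity_derivative[of x] that by (simp add: at_within_halfline divide_inverse mult_ac)
  qed
  moreover have "diff_order (Suc n) {0<..} shear"
  proof (rule diff_order_SucI[OF openin_pos _
        diff_order_mult[OF openin_pos diff_order_const[OF openin_pos, of n "- 1 / 2"] prod]])
    fix x :: real assume "x \<in> {0<..}"
    then have x: "x > 0" by simp
    have "- x * shear x / (2 * velocity x) = - 1 / 2 * (x * (shear x * inverse (velocity x)))"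
      using velocity_pos[OF x] by (simp add: field_simps)
    with shear_derivative[OF x]
    show "(shear has_real_derivative - 1 / 2 * (x * (shear x * inverse (velocity x)))) (at x within {0..})"
      unfolding at_within_halfline[OF x] by (rule DERIV_cong)
  qed
  ultimately show ?case ..
qed simp

text \<open>As a function of \<open>\<psi>\<close>, \<open>eigf\<close> is not smooth at \<open>0\<close> (it is smooth in \<open>z\<close>, which behaves like
  the square root of \<open>\<psi>\<close>). Hence the cut-off near \<open>0\<close>, and not only at infinity.\<close>

definition trial :: "nat \<Rightarrow> real \<Rightarrow> real" where
  "trial n x = eigf x * cutoff n x"

lemma trial_Cc_infinity:
  assumes n: "n > 0"
  shows "trial n \<in> Cc_infinity"
proof -
  have "{0..} = {0<..} \<union> {0..<d}" if "0 < d" for d :: real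
    using that by auto
  from this[of "1 / real n"] have cover: "{0..} = {0<..} \<union> {0..<1 / real n}"
    using n by simp
  have pos: "diff_order k {0<..} (trial n)" for k
  proof -
    have "diff_order k {0<..} (\<lambda>x. sqrt 2 * x * shear x * cutoff n x)"
      using diff_order_velocity_shear
      by (intro diff_order_mult[OF openin_pos] diff_order_const[OF openin_pos]
          diff_order_id[OF openin_pos] diff_order_cutoff[OF openin_pos]) auto
    then show ?thesis by (simp add: trial_def[abs_def] eigf_def)
  qed
  have near_0: "diff_order k {0..<1 / real n} (trial n)" for k
  proof -
    have "{0..<1 / real n} = {0..} \<inter> {..<1 / real n}" by auto
    then have op: "openin (top_of_set {0..}) {0..<1 / real n}"
      by (simp add: openin_open_Int)
    show ?thesis
    proof (rule diff_order_cong[OF op _ diff_order_const[OF op, of k 0]])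
      fix x assume "x \<in> {0..<1 / real n}"
      then have "\<not> n * x - 1 > 0" using n by (simp add: field_simps)
      then show "0 = trial n x" by (simp add: trial_def cutoff_def flat_def)
    qed
  qed
  have smooth: "diff_order k {0..} (trial n)" for k
    unfolding cover by (rule diff_order_Un[OF pos near_0])
  have "{x. x \<ge> 0 \<and> trial n x \<noteq> 0} \<subseteq> {0..2 * real n}"
  proof
    fix x assume x: "x \<in> {x. x \<ge> 0 \<and> trial n x \<noteq> 0}"
    then have "flat (2 - x / n) \<noteq> 0"
      by (simp add: trial_def cutoff_def)
    then have "x / n < 2"
      by (simp add: flat_def split: if_splits)
    then have "x < 2 * real n"
      using n by (simp add: pos_divide_less_eq)
    then show "x \<in> {0..2 * real n}"
      using x by simp
  qed
  then have "bounded {x. x \<ge> 0 \<and> trial n x \<noteq> 0}"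
    by (rule bounded_subset[OF bounded_closed_interval])
  then have "compact (closure {x. x \<ge> 0 \<and> trial n x \<noteq> 0})"
    by (simp only: compact_closure)
  moreover have "\<forall>k. \<forall>x\<ge>0. (hderiv ^^ k) (trial n) differentiable (at x within {0..})"
    by (intro allI impI diff_order_iterate[OF smooth lessI])
  ultimately show ?thesis
    unfolding Cc_infinity_def by (intro CollectI conjI)
qed

lemma trial_0: "trial n 0 = 0"
  by (simp add: trial_def eigf_def)

lemma defect_trial:
  assumes x: "x > 0"
  shows "defect (trial n) x = 2 * shear 0 * (shear x * (x * cutoff' n x)\<^sup>2)"
proof -
  have "(trial n has_real_derivative kappa x * eigf x * cutoff n x + cutoff' n x * eigf x) (at x)"
    unfolding trial_def[abs_def] by (rule DERIV_mult[OF eigf_derivative[OF x] cutoff_derivative])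
  from hderiv_eqI_pos[OF x this]
  have "hderiv (trial n) x - kappa x * trial n x = eigf x * cutoff' n x"
    by (simp add: trial_def)
  then show ?thesis
    using shear_pos[of x] x by (simp add: defect_def eigf_def power2_eq_square)
qed

text \<open>By \<open>defect_trial\<close> the integrand is a multiple of \<open>shear x * (x * cutoff' n x)\<^sup>2\<close>: dominated by
  a multiple of the integrable function \<open>shear\<close>, and pointwise convergent to \<open>0\<close>.\<close>

lemma defect_trial_tendsto:
  "(\<lambda>n. LBINT x:{0<..}. defect (trial (Suc n)) x) \<longlonglongrightarrow> 0"
proof -
  let ?g = "\<lambda>n x. indicator {0<..} x * (2 * shear 0 * (shear x * (x * cutoff' (Suc n) x)\<^sup>2)) :: real"
  have eq: "indicator {0<..} x *\<^sub>R defect (trial (Suc n)) x = ?g n x" for n x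
    by (auto simp: indicator_def defect_trial)
  have "(\<lambda>n. integral\<^sup>L lborel (?g n)) \<longlonglongrightarrow> integral\<^sup>L lborel (\<lambda>x :: real. 0 :: real)"
  proof (rule integral_dominated_convergence)
    have "set_integrable lborel {0<..} (\<lambda>x. 2 * shear 0 * 49 * shear x)"
      by (intro set_integrable_mult_right shear_integrable)
    then show "integrable lborel (\<lambda>x. indicator {0<..} x * (2 * shear 0 * 49 * shear x))"
      by (simp add: set_integrable_def)
    show "?g n \<in> borel_measurable lborel" for n
      using ground_state_identity(2)[OF trial_Cc_infinity[OF zero_less_Suc] trial_0, of n]
      unfolding set_integrable_def eq by simp
    show "AE x in lborel. (\<lambda>n. ?g n x) \<longlonglongrightarrow> 0"
    proof (intro AE_I2)
      fix x :: real
      show "(\<lambda>n. ?g n x) \<longlonglongrightarrow> 0"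
      proof (cases "x > 0")
        case True
        have "(\<lambda>n. 2 * shear 0 * (shear x * (x * cutoff' (Suc n) x)\<^sup>2)) \<longlonglongrightarrow> 2 * shear 0 * (shear x * 0\<^sup>2)"
          by (intro tendsto_intros LIMSEQ_Suc cutoff'_tendsto_0 True)
        then show ?thesis using True by (simp add: indicator_def)
      qed (simp add: indicator_def)
    qed
    show "AE x in lborel. norm (?g n x) \<le> indicator {0<..} x * (2 * shear 0 * 49 * shear x)" for n
    proof (intro AE_I2)
      fix x :: real
      show "norm (?g n x) \<le> indicator {0<..} x * (2 * shear 0 * 49 * shear x)"
      proof (cases "x > 0")
        case True
        have "(x * cutoff' (Suc n) x)\<^sup>2 \<le> 7\<^sup>2"
          using cutoff'_bounded(2)[OF zero_less_Suc True] by (intro abs_le_square_iff[THEN iffD1]) simp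
        then have "2 * shear 0 * (shear x * (x * cutoff' (Suc n) x)\<^sup>2) \<le> 2 * shear 0 * (shear x * 49)"
          using shear_pos[of 0] shear_pos[of x] True by (intro mult_left_mono) auto
        then show ?thesis
          using True shear_pos[of 0] shear_pos[of x] by (simp add: indicator_def mult_ac)
      qed (simp add: indicator_def)
    qed
  qed simp
  then show ?thesis
    unfolding set_lebesgue_integral_def eq by simp
qed

text \<open>On the fixed interval \<open>{1..2}\<close> both arguments of \<open>flat\<close> in \<open>cutoff n\<close> are at least \<open>1\<close>, so
  the mass does not degenerate along the sequence.\<close>

lemma mass_trial_ge:
  assumes n: "n \<ge> 2"
  shows "2 * shear 0 * shear 2 * exp (- 1) ^ 4 \<le> (LBINT x:{0<..}. mass (trial n) x)"
proof -
  have "2 * shear 0 * shear 2 * exp (- 1) ^ 4 * (2 - 1) \<le> (LBINT x:{0<..}. mass (trial n) x)"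
  proof (rule set_integral_halfline_ge)
    show "set_integrable lborel {0<..} (mass (trial n))"
      using ground_state_identity(1)[OF trial_Cc_infinity trial_0] n by simp
    show "0 \<le> mass (trial n) x" if "0 < x" for x
      using that shear_pos[of 0] shear_pos[of x] velocity_pos[of x] by (simp add: mass_def)
    fix x :: real assume x: "1 \<le> x" "x \<le> 2"
    have u: "0 < velocity x" "velocity x \<le> 1" using x velocity_pos velocity_le_1 by auto
    have t: "0 < shear 0" "0 < shear 2" "shear 2 \<le> shear x" using x shear_pos shear_antimono by auto
    have "1 * 1 \<le> n * x - 1" 
      using mult_mono[of 2 "real n" 1 x] n x by simp
    moreover have "x / n \<le> 1" using n x by simp
    ultimately have "exp (- 1) * exp (- 1) \<le> cutoff n x"
      unfolding cutoff_def by (intro mult_mono flat_ge flat_bounds) auto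
    then have "(exp (- 1) * exp (- 1))\<^sup>2 \<le> (cutoff n x)\<^sup>2"
      by (intro power_mono) auto
    moreover have "1 \<le> x\<^sup>2" using x by simp
    moreover have "1 \<le> 1 / velocity x" using u by simp
    ultimately have "1 * (1 * (shear 2 * (exp (- 1) * exp (- 1))\<^sup>2)) \<le> 1 / velocity x * (x\<^sup>2 * (shear x * (cutoff n x)\<^sup>2))"
      using t u by (intro mult_mono) auto
    then have "2 * shear 0 * (1 * (1 * (shear 2 * (exp (- 1) * exp (- 1))\<^sup>2)))
        \<le> 2 * shear 0 * (1 / velocity x * (x\<^sup>2 * (shear x * (cutoff n x)\<^sup>2)))"
      using t by (intro mult_left_mono) auto
    also have "\<dots> = mass (trial n) x"
      using t by (simp add: mass_def trial_def eigf_def power2_eq_square)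
    finally show "2 * shear 0 * shear 2 * exp (- 1) ^ 4 \<le> mass (trial n) x"
      by (simp add: power4_eq_xxxx power2_eq_square mult_ac)
  qed auto
  then show ?thesis by simp
qed

lemma rayleigh_trial_tendsto: "(\<lambda>n. rayleigh f (trial (Suc (Suc n)))) \<longlonglongrightarrow> 1"
proof -
  define K where "K = 2 * shear 0 * shear 2 * exp (- 1) ^ 4"
  have K: "K > 0" using shear_pos[of 0] shear_pos[of 2] by (simp add: K_def)
  define I where "I n = (LBINT x:{0<..}. defect (trial (Suc (Suc n))) x)" for n
  have I: "I \<longlonglongrightarrow> 0" unfolding I_def using LIMSEQ_Suc[OF defect_trial_tendsto] .
  have bound: "\<bar>rayleigh f (trial (Suc (Suc n))) - 1\<bar> \<le> I n / K" for n
  proof -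
    let ?d = "LBINT x:{0<..}. mass (trial (Suc (Suc n))) x"
    have d: "K \<le> ?d" unfolding K_def by (rule mass_trial_ge) simp
    have I0: "0 \<le> I n"
      unfolding I_def by (rule defect_integral_nonneg)
    have "rayleigh f (trial (Suc (Suc n))) - 1 = I n / ?d"
      using d K ground_state_identity(3)[OF trial_Cc_infinity[OF zero_less_Suc] trial_0, of "Suc n"]
      by (simp add: rayleigh_eq I_def add_divide_distrib)
    also have "\<dots> \<le> I n / K" using d K I0 by (intro divide_left_mono mult_pos_pos) auto
    finally show ?thesis
      using I0 d K \<open>rayleigh f (trial (Suc (Suc n))) - 1 = I n / ?d\<close> by simp
  qed
  have "(\<lambda>n. I n / K) \<longlonglongrightarrow> 0"
    using tendsto_divide[OF I tendsto_const[of K]] K by simp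
  moreover have "\<forall>\<^sub>F n in sequentially. norm (rayleigh f (trial (Suc (Suc n))) - 1) \<le> I n / K"
    unfolding real_norm_def by (intro always_eventually allI bound)
  ultimately have "(\<lambda>n. rayleigh f (trial (Suc (Suc n))) - 1) \<longlonglongrightarrow> 0"
    by (rule Lim_null_comparison[rotated])
  then show ?thesis by (rule LIM_zero_cancel)
qed

lemma principal_eigenvalue_eq_1: "principal_eigenvalue f = 1"
proof (rule antisym)
  show "1 \<le> principal_eigenvalue f"
    unfolding principal_eigenvalue_def
  proof (rule INF_greatest)
    fix v assume "v \<in> {v \<in> Cc_infinity. v 0 = 0 \<and> (\<exists>x\<ge>0. v x \<noteq> 0)}"
    then have "1 \<le> rayleigh f v" by (intro rayleigh_ge_1) auto
    then show "1 \<le> ereal (rayleigh f v)" by (simp add: one_ereal_def)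
  qed
  have upper: "principal_eigenvalue f \<le> ereal (rayleigh f (trial (Suc (Suc n))))" for n
    unfolding principal_eigenvalue_def
  proof (rule INF_lower, intro CollectI conjI trial_Cc_infinity trial_0 exI[of _ 1])
    have "0 < flat (real (Suc (Suc n)) * 1 - 1)" "0 < flat (2 - 1 / real (Suc (Suc n)))"
      by (auto simp: flat_def divide_less_eq)
    then show "trial (Suc (Suc n)) 1 \<noteq> 0"
      using shear_pos[of 1] by (simp add: trial_def eigf_def cutoff_def)
  qed auto
  have "(\<lambda>n. ereal (rayleigh f (trial (Suc (Suc n))))) \<longlonglongrightarrow> ereal 1"
    using rayleigh_trial_tendsto by simp
  then have "principal_eigenvalue f \<le> ereal 1"
    by (rule LIMSEQ_le_const) (intro exI[of _ 0] allI impI upper)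
  then show "principal_eigenvalue f \<le> 1" by (simp add: one_ereal_def)
qed

end

theorem propositionA1:
  fixes f :: "real \<Rightarrow> real"
  assumes "blasius f"
  shows "principal_eigenvalue f = 1
    \<and> is_eigenfunction f 1 (\<lambda>\<psi>. \<psi> * hderiv (omega f) \<psi>)"
proof -
  interpret blasius_flow f by unfold_locales (rule assms)
  show ?thesis
    using principal_eigenvalue_eq_1 eigenfunction by simp
qed

end
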